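(* The BRST operator $Q$ of a Hamiltonian algebroid $\mathcal{A}^H$ has rank one: it is $Q\psi=\{\psi,\Omega\}$ with $$\Omega=\langle\eta|F\rangle+\tfrac12\langle\lfloor\eta,\eta'\rfloor|\mathcal{P}\rangle:=\sum_j\eta_jh^j+\tfrac12\sum_{i,j,k}f^{jk}_i(x)\,\eta_k\eta_j\,\mathcal{P}^i .$$ That is, this $\Omega$ (which contains no terms of order higher than one in the ghost momenta $\mathcal{P}$) satisfies $\{\Omega,\Omega\}=0$, so that $Q^2=0$.
   Context: A Lie algebroid over a manifold $M$ is a vector bundle $\mathcal{A}\to M$ with a Lie bracket $\lfloor\cdot,\cdot\rfloor$ on $\Gamma(\mathcal{A})$ and an anchor $\delta:\mathcal{A}\to TM$ with $[\delta_{\varepsilon_1},\delta_{\varepsilon_2}]=\delta_{\lfloor\varepsilon_1,\varepsilon_2\rfloor}$ and $\lfloor\varepsilon_1,f\varepsilon_2\rfloor=f\lfloor\varepsilon_1,\varepsilon_2\rfloor+(\delta_{\varepsilon_1}f)\varepsilon_2$ for functions $f$ on $M$. Let $\{e^j\}$ be a basis of sections, with structure functions $f^{jk}_i$ on $M$ defined by $\lfloor e^j,e^k\rfloor=\sum_if^{jk}_i(x)e^i$. An affine space $\mathcal{R}$ over $T^*M$ is a bundle over $M$ glued from the cotangent bundles $T^*\mathcal{U}_\alpha$ of contractible charts by $\xi_\alpha=\xi_\beta+\varsigma_{\alpha\beta}$, where $\varsigma_{\alpha\beta}$ is a cocycle of closed one-forms; it is symplectic with local form $\omega=\sum_ad\xi_a\wedge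 dx^a$, and its Poisson bracket is normalized by $\{\xi_a,x^b\}=\delta_a^b$. A Hamiltonian algebroid $\mathcal{A}^H$ is a Lie algebroid $\mathcal{A}$ over $M$ together with a lift of its anchor action to a hamiltonian action on such an $\mathcal{R}$ with Hamiltonians $h_\varepsilon=\langle\delta_\varepsilon|\xi\rangle+c(x;\varepsilon)$. Here $\langle\delta_\varepsilon|\xi\rangle$ is the pairing of vector and covector, and $c$ is a (local representative of a) $1$-cocycle, linear over functions in $\varepsilon$, with $c(x;\lfloor\varepsilon_1,\varepsilon_2\rfloor)=\delta_{\varepsilon_1}c(x;\varepsilon_2)-\delta_{\varepsilon_2}c(x;\varepsilon_1)$. Consequently $\{h_{\varepsilon_1},h_{\varepsilon_2}\}=h_{\lfloor\varepsilon_1,\varepsilon_2\rfloor}$ and $\{h_\varepsilon,f\}=\delta_\varepsilon f$ for functions $f$ pulled back from $M$. Write $h^j=h_{e^j}=\langle e^j|F\rangle$, where $F:\mathcal{R}\to\Gamma(\mathcal{A}^* )$ is the moment map. The Batalin–Fradkin–Volkovisky algebra is the graded-commutative algebra generated over functions on $\mathcal{R}$ by odd ghosts $\eta_j$ (the basis of $\Gamma(\mathcal{A}^* )$ dual to $e^j$, ghost number $+1$) and odd ghost momenta $\mathcal{P}^j$ (ghost number $-1$). It has the graded Poisson bracket extending that of $\mathcal{R}$ by $$\{\eta_j,\mathcal{P}^k\}=\{\mathcal{P}^k,\eta_j\}=\delta_j^k,\quad\{\eta_j,\eta_k\}=\{\mathcal{P}^j,\mathcal{P}^k\}=0,\quad\{\eta_j,g\}=\{\mathcal{P}^k,g\}=0$$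 for functions $g$ on $\mathcal{R}$, with graded Leibniz rules $\{AB,C\}=A\{B,C\}+(-1)^{|B||C|}\{A,C\}B$ and $\{A,BC\}=\{A,B\}C+(-1)^{|A||B|}B\{A,C\}$; the bracket of two odd elements is symmetric. A BRST operator is a nilpotent operator $Q=\{\cdot,\Omega\}$ of ghost number one, with $\Omega$ odd and $\Omega=\sum_j\eta_jh^j+\tfrac12\langle\lfloor\eta,\eta'\rfloor|\mathcal{P}\rangle+(\text{terms of higher order in }\mathcal{P})$; nilpotency is equivalent to $\{\Omega,\Omega\}=0$. Its rank is the highest order of $\mathcal{P}$ in $\Omega$. *)

theory Defs
  imports "HOL-Analysis.Analysis"
begin

section \<open>Smooth maps between open subsets of normed spaces\<close>

text \<open>For open \<open>S\<close> and finite-dimensional domain, continuity of all iterated directional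
  derivatives up to order \<open>k\<close> is the usual notion of class \<open>C^k\<close>.\<close>

primrec Ck_on :: "nat \<Rightarrow> 'a::real_normed_vector set \<Rightarrow> ('a \<Rightarrow> 'b::real_normed_vector) \<Rightarrow> bool" where
  "Ck_on 0 S f \<longleftrightarrow> continuous_on S f"
| "Ck_on (Suc k) S f \<longleftrightarrow>
     f differentiable_on S \<and> (\<forall>v. Ck_on k S (\<lambda>x. frechet_derivative f (at x) v))"

definition smooth_on :: "'a::real_normed_vector set \<Rightarrow> ('a \<Rightarrow> 'b::real_normed_vector) \<Rightarrow> bool" where
  "smooth_on S f \<longleftrightarrow> (\<forall>k. Ck_on k S f)"

section \<open>Smooth manifolds\<close>

text \<open>The charts are indexed by all of the type \<open>'i\<close>; since charts may be repeated,
  any nonempty index set can be presented in this way.\<close>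

record ('m, 'i, 'n::finite) atlas =
  chart_dom :: "'i \<Rightarrow> 'm set"
  chart :: "'i \<Rightarrow> 'm \<Rightarrow> real ^ 'n"

definition chart_inv :: "('m, 'i, 'n::finite) atlas \<Rightarrow> 'i \<Rightarrow> real ^ 'n \<Rightarrow> 'm" where
  "chart_inv M \<alpha> = inv_into (chart_dom M \<alpha>) (chart M \<alpha>)"

definition transition :: "('m, 'i, 'n::finite) atlas \<Rightarrow> 'i \<Rightarrow> 'i \<Rightarrow> real ^ 'n \<Rightarrow> real ^ 'n" where
  "transition M \<alpha> \<beta> = chart M \<beta> \<circ> chart_inv M \<alpha>"

definition jacobian :: "('m, 'i, 'n::finite) atlas \<Rightarrow> 'i \<Rightarrow> 'i \<Rightarrow> 'm \<Rightarrow> real ^ 'n \<Rightarrow> real ^ 'n" where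
  "jacobian M \<alpha> \<beta> p = frechet_derivative (transition M \<alpha> \<beta>) (at (chart M \<alpha> p))"

definition chart_at :: "('m, 'i, 'n::finite) atlas \<Rightarrow> 'm \<Rightarrow> 'i" where
  "chart_at M p = (SOME \<alpha>. p \<in> chart_dom M \<alpha>)"

locale smooth_manifold =
  fixes M :: "('m::{t2_space, second_countable_topology}, 'i, 'n::finite) atlas"
  assumes open_dom: "open (chart_dom M \<alpha>)"
    and cover: "(\<Union>\<alpha>. chart_dom M \<alpha>) = UNIV"
    and open_image: "open (chart M \<alpha> ` chart_dom M \<alpha>)"
    and chart_homeo: "homeomorphism (chart_dom M \<alpha>) (chart M \<alpha> ` chart_dom M \<alpha>)
                        (chart M \<alpha>) (chart_inv M \<alpha>)"
    and smooth_transition: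
      "smooth_on (chart M \<alpha> ` (chart_dom M \<alpha> \<inter> chart_dom M \<beta>)) (transition M \<alpha> \<beta>)"

definition smooth_fun_on ::
    "('m, 'i, 'n::finite) atlas \<Rightarrow> 'm set \<Rightarrow> ('m \<Rightarrow> 'b::real_normed_vector) \<Rightarrow> bool" where
  "smooth_fun_on M W f \<longleftrightarrow>
     (\<forall>\<alpha>. smooth_on (chart M \<alpha> ` (chart_dom M \<alpha> \<inter> W)) (f \<circ> chart_inv M \<alpha>))"

abbreviation smooth_fun ::
    "('m, 'i, 'n::finite) atlas \<Rightarrow> ('m \<Rightarrow> 'b::real_normed_vector) \<Rightarrow> bool" where
  "smooth_fun M \<equiv> smooth_fun_on M UNIV"

subsection \<open>Vector fields\<close>

text \<open>A tangent vector at \<open>p\<close> is the family of its component vectors in the charts around \<open>p\<close>,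
  related by the Jacobians; components in charts that do not contain \<open>p\<close> are irrelevant.\<close>

definition tangent_at :: "('m, 'i, 'n::finite) atlas \<Rightarrow> 'm \<Rightarrow> ('i \<Rightarrow> real ^ 'n) \<Rightarrow> bool" where
  "tangent_at M p t \<longleftrightarrow>
     (\<forall>\<alpha> \<beta>. p \<in> chart_dom M \<alpha> \<inter> chart_dom M \<beta> \<longrightarrow> t \<beta> = jacobian M \<alpha> \<beta> p (t \<alpha>))"

definition vector_field :: "('m, 'i, 'n::finite) atlas \<Rightarrow> ('m \<Rightarrow> 'i \<Rightarrow> real ^ 'n) \<Rightarrow> bool" where
  "vector_field M v \<longleftrightarrow>
     (\<forall>p. tangent_at M p (v p)) \<and> (\<forall>\<alpha>. smooth_fun_on M (chart_dom M \<alpha>) (\<lambda>p. v p \<alpha>))"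

text \<open>The derivative \<open>v f\<close> of a function along a vector field. By the chain rule the value at \<open>p\<close>
  is the same in every chart around \<open>p\<close>, so it is computed in a chosen one.\<close>

definition vf_apply ::
    "('m, 'i, 'n::finite) atlas \<Rightarrow> ('m \<Rightarrow> 'i \<Rightarrow> real ^ 'n) \<Rightarrow> ('m \<Rightarrow> real) \<Rightarrow> 'm \<Rightarrow> real" where
  "vf_apply M v f p = (let \<alpha> = chart_at M p in
     frechet_derivative (f \<circ> chart_inv M \<alpha>) (at (chart M \<alpha> p)) (v p \<alpha>))"

text \<open>Components of the Lie bracket \<open>[v, w]\<close> of vector fields in the chart \<open>\<alpha>\<close>.\<close>

definition vf_bracket ::
    "('m, 'i, 'n::finite) atlas \<Rightarrow> ('m \<Rightarrow> 'i \<Rightarrow> real ^ 'n) \<Rightarrow> ('m \<Rightarrow> 'i \<Rightarrow> real ^ 'n)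
      \<Rightarrow> 'm \<Rightarrow> 'i \<Rightarrow> real ^ 'n" where
  "vf_bracket M v w p \<alpha> =
     frechet_derivative ((\<lambda>q. w q \<alpha>) \<circ> chart_inv M \<alpha>) (at (chart M \<alpha> p)) (v p \<alpha>)
   - frechet_derivative ((\<lambda>q. v q \<alpha>) \<circ> chart_inv M \<alpha>) (at (chart M \<alpha> p)) (w p \<alpha>)"

section \<open>Vector bundles and Lie algebroids\<close>

text \<open>The fibres of a vector bundle of rank \<open>CARD('j)\<close> are realised as subspaces of an arbitrary
  real vector space \<open>'v\<close>; the smooth structure is given by a set of local frames \<open>(W, b)\<close>,
  with \<open>b\<close> a frame over the open set \<open>W\<close> (equivalently, local trivialisations).\<close>

record ('m, 'i, 'n::finite, 'j, 'v) algebroid =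
  fibre :: "'m \<Rightarrow> 'v set"
  local_frames :: "('m set \<times> ('j \<Rightarrow> 'm \<Rightarrow> 'v)) set"
  bracket :: "('m \<Rightarrow> 'v) \<Rightarrow> ('m \<Rightarrow> 'v) \<Rightarrow> ('m \<Rightarrow> 'v)"
  anchor :: "'m \<Rightarrow> 'v \<Rightarrow> 'i \<Rightarrow> real ^ 'n"

definition frame_coeff :: "('j \<Rightarrow> 'm \<Rightarrow> 'v::real_vector) \<Rightarrow> 'm \<Rightarrow> 'v \<Rightarrow> 'j \<Rightarrow> real" where
  "frame_coeff b p u k = representation (range (\<lambda>j. b j p)) u (b k p)"

definition sections ::
    "('m, 'i, 'n::finite) atlas \<Rightarrow> ('m, 'i, 'n, 'j, 'v::real_vector) algebroid \<Rightarrow> ('m \<Rightarrow> 'v) set" where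
  "sections M A = {s. (\<forall>p. s p \<in> fibre A p) \<and>
     (\<forall>(W, b) \<in> local_frames A. \<forall>k. smooth_fun_on M W (\<lambda>p. frame_coeff b p (s p) k))}"

definition anchor_field ::
    "('m, 'i, 'n::finite, 'j, 'v) algebroid \<Rightarrow> ('m \<Rightarrow> 'v) \<Rightarrow> 'm \<Rightarrow> 'i \<Rightarrow> real ^ 'n" where
  "anchor_field A s p = anchor A p (s p)"

locale vector_bundle = smooth_manifold M
  for M :: "('m::{t2_space, second_countable_topology}, 'i, 'n::finite) atlas" +
  fixes A :: "('m, 'i, 'n, 'j::finite, 'v::real_vector) algebroid"
  assumes frame_open: "(W, b) \<in> local_frames A \<Longrightarrow> open W"
    and frame_cover: "(\<Union>(W, b) \<in> local_frames A. W) = UNIV"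
    and frame_basis: "\<lbrakk>(W, b) \<in> local_frames A; p \<in> W\<rbrakk> \<Longrightarrow>
      inj (\<lambda>j. b j p) \<and> independent (range (\<lambda>j. b j p)) \<and> span (range (\<lambda>j. b j p)) = fibre A p"
    and frame_transition: "\<lbrakk>(W, b) \<in> local_frames A; (W', b') \<in> local_frames A\<rbrakk> \<Longrightarrow>
      smooth_fun_on M (W \<inter> W') (\<lambda>p. frame_coeff b p (b' j p) k)"

locale lie_algebroid = vector_bundle M A
  for M :: "('m::{t2_space, second_countable_topology}, 'i, 'n::finite) atlas"
    and A :: "('m, 'i, 'n, 'j::finite, 'v::real_vector) algebroid" +
  assumes bracket_section:
      "\<lbrakk>s \<in> sections M A; t \<in> sections M A\<rbrakk> \<Longrightarrow> bracket A s t \<in> sections M A"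
    and bracket_add: "\<lbrakk>s \<in> sections M A; s' \<in> sections M A; t \<in> sections M A\<rbrakk> \<Longrightarrow>
      bracket A (\<lambda>p. s p + s' p) t = (\<lambda>p. bracket A s t p + bracket A s' t p)"
    and bracket_scale: "\<lbrakk>s \<in> sections M A; t \<in> sections M A\<rbrakk> \<Longrightarrow>
      bracket A (\<lambda>p. a *\<^sub>R s p) t = (\<lambda>p. a *\<^sub>R bracket A s t p)"
    and bracket_antisym: "\<lbrakk>s \<in> sections M A; t \<in> sections M A\<rbrakk> \<Longrightarrow>
      bracket A s t = (\<lambda>p. - bracket A t s p)"
    and bracket_jacobi: "\<lbrakk>s \<in> sections M A; s' \<in> sections M A; t \<in> sections M A\<rbrakk> \<Longrightarrow>
      bracket A s (bracket A s' t) p + bracket A s' (bracket A t s) p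
        + bracket A t (bracket A s s') p = 0"
    and anchor_tangent: "u \<in> fibre A p \<Longrightarrow> tangent_at M p (anchor A p u)"
    and anchor_add: "\<lbrakk>u \<in> fibre A p; w \<in> fibre A p; p \<in> chart_dom M \<alpha>\<rbrakk> \<Longrightarrow>
      anchor A p (u + w) \<alpha> = anchor A p u \<alpha> + anchor A p w \<alpha>"
    and anchor_scale: "\<lbrakk>u \<in> fibre A p; p \<in> chart_dom M \<alpha>\<rbrakk> \<Longrightarrow>
      anchor A p (a *\<^sub>R u) \<alpha> = a *\<^sub>R anchor A p u \<alpha>"
    and anchor_smooth: "s \<in> sections M A \<Longrightarrow> vector_field M (anchor_field A s)"
    and anchor_bracket: "\<lbrakk>s \<in> sections M A; t \<in> sections M A; p \<in> chart_dom M \<alpha>\<rbrakk> \<Longrightarrow>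
      vf_bracket M (anchor_field A s) (anchor_field A t) p \<alpha> = anchor_field A (bracket A s t) p \<alpha>"
    and bracket_leibniz:
      "\<lbrakk>s \<in> sections M A; t \<in> sections M A; smooth_fun M (g :: 'm \<Rightarrow> real)\<rbrakk> \<Longrightarrow>
      bracket A s (\<lambda>p. g p *\<^sub>R t p) =
        (\<lambda>p. g p *\<^sub>R bracket A s t p + vf_apply M (anchor_field A s) g p *\<^sub>R t p)"

text \<open>A basis of the \<open>C\<^sup>\<infinity>(M)\<close>-module of sections.\<close>

definition section_basis ::
    "('m, 'i, 'n::finite) atlas \<Rightarrow> ('m, 'i, 'n, 'j::finite, 'v::real_vector) algebroid
      \<Rightarrow> ('j \<Rightarrow> 'm \<Rightarrow> 'v) \<Rightarrow> bool" where
  "section_basis M A e \<longleftrightarrow> (\<forall>j. e j \<in> sections M A) \<and>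
     (\<forall>s \<in> sections M A. \<exists>!g :: 'j \<Rightarrow> 'm \<Rightarrow> real.
        (\<forall>j. smooth_fun M (g j)) \<and> s = (\<lambda>p. \<Sum>j\<in>UNIV. g j p *\<^sub>R e j p))"

text \<open>\<open>f j k i\<close> is the structure function with upper indices \<open>j, k\<close> and lower index \<open>i\<close>.\<close>

definition structure_functions ::
    "('m, 'i, 'n::finite) atlas \<Rightarrow> ('m, 'i, 'n, 'j::finite, 'v::real_vector) algebroid
      \<Rightarrow> ('j \<Rightarrow> 'm \<Rightarrow> 'v) \<Rightarrow> ('j \<Rightarrow> 'j \<Rightarrow> 'j \<Rightarrow> 'm \<Rightarrow> real) \<Rightarrow> bool" where
  "structure_functions M A e f \<longleftrightarrow>
     (\<forall>j k i. smooth_fun M (f j k i)) \<and>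
     (\<forall>j k. bracket A (e j) (e k) = (\<lambda>p. \<Sum>i\<in>UNIV. f j k i p *\<^sub>R e i p))"

section \<open>Affine spaces over the cotangent bundle\<close>

text \<open>\<open>momenta R \<alpha> r\<close> is the component vector, in the chart \<open>\<alpha>\<close> of \<open>M\<close>, of the covector \<open>\<xi>\<^sub>\<alpha>\<close> that
  represents \<open>r\<close> in the piece \<open>T\<^sup>*U\<^sub>\<alpha>\<close>; \<open>shift R \<alpha> \<beta>\<close> are the components of the one-form
  \<open>\<varsigma>\<^sub>\<alpha>\<^sub>\<beta>\<close> in the chart \<open>\<alpha>\<close>.
  The components of a covector pass from chart \<open>\<beta>\<close> to chart \<open>\<alpha>\<close> by the transpose of the Jacobian of
  \<open>x\<^sub>\<alpha> \<mapsto> x\<^sub>\<beta>\<close>.\<close>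

record ('m, 'i, 'n::finite, 'r) affine_bundle =
  proj :: "'r \<Rightarrow> 'm"
  momenta :: "'i \<Rightarrow> 'r \<Rightarrow> real ^ 'n"
  shift :: "'i \<Rightarrow> 'i \<Rightarrow> 'm \<Rightarrow> real ^ 'n"

locale affine_cotangent = smooth_manifold M
  for M :: "('m::{t2_space, second_countable_topology}, 'i, 'n::finite) atlas" +
  fixes R :: "('m, 'i, 'n, 'r) affine_bundle"
  assumes contractible_dom: "contractible (chart_dom M \<alpha>)"
    and pieces: "bij_betw (\<lambda>r. (proj R r, momenta R \<alpha> r))
                   (proj R -` chart_dom M \<alpha>) (chart_dom M \<alpha> \<times> UNIV)"
    and shift_smooth: "smooth_fun_on M (chart_dom M \<alpha> \<inter> chart_dom M \<beta>) (shift R \<alpha> \<beta>)"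
    and shift_closed: "p \<in> chart_dom M \<alpha> \<inter> chart_dom M \<beta> \<Longrightarrow>
      frechet_derivative (shift R \<alpha> \<beta> \<circ> chart_inv M \<alpha>) (at (chart M \<alpha> p)) u \<bullet> w =
      frechet_derivative (shift R \<alpha> \<beta> \<circ> chart_inv M \<alpha>) (at (chart M \<alpha> p)) w \<bullet> u"
    and shift_cocycle: "p \<in> chart_dom M \<alpha> \<inter> chart_dom M \<beta> \<inter> chart_dom M \<gamma> \<Longrightarrow>
      shift R \<alpha> \<gamma> p = shift R \<alpha> \<beta> p + adjoint (jacobian M \<alpha> \<beta> p) (shift R \<beta> \<gamma> p)"
    and glue: "proj R r \<in> chart_dom M \<alpha> \<inter> chart_dom M \<beta> \<Longrightarrow>
      momenta R \<alpha> r =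
        adjoint (jacobian M \<alpha> \<beta> (proj R r)) (momenta R \<beta> r) + shift R \<alpha> \<beta> (proj R r)"

definition darboux ::
    "('m, 'i, 'n::finite) atlas \<Rightarrow> ('m, 'i, 'n, 'r) affine_bundle \<Rightarrow> 'i \<Rightarrow> 'r
      \<Rightarrow> (real ^ 'n) \<times> (real ^ 'n)" where
  "darboux M R \<alpha> r = (chart M \<alpha> (proj R r), momenta R \<alpha> r)"

definition darboux_inv ::
    "('m, 'i, 'n::finite) atlas \<Rightarrow> ('m, 'i, 'n, 'r) affine_bundle \<Rightarrow> 'i
      \<Rightarrow> (real ^ 'n) \<times> (real ^ 'n) \<Rightarrow> 'r" where
  "darboux_inv M R \<alpha> = inv_into (proj R -` chart_dom M \<alpha>) (darboux M R \<alpha>)"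

definition smooth_total ::
    "('m, 'i, 'n::finite) atlas \<Rightarrow> ('m, 'i, 'n, 'r) affine_bundle \<Rightarrow> ('r \<Rightarrow> real) \<Rightarrow> bool" where
  "smooth_total M R F \<longleftrightarrow>
     (\<forall>\<alpha>. smooth_on (chart M \<alpha> ` chart_dom M \<alpha> \<times> UNIV) (F \<circ> darboux_inv M R \<alpha>))"

text \<open>The Poisson bracket of \<open>\<omega> = \<Sum> d\<xi>\<^sub>a \<and> dx\<^sup>a\<close>, normalised by \<open>{\<xi>\<^sub>a, x\<^sup>b} = \<delta>\<^sub>a\<^sup>b\<close>. As the shifts are
  closed, \<open>\<omega>\<close> does not depend on the chart, so the value at \<open>r\<close> is computed in a chosen one.\<close>

definition poisson ::
    "('m, 'i, 'n::finite) atlas \<Rightarrow> ('m, 'i, 'n, 'r) affine_bundle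
      \<Rightarrow> ('r \<Rightarrow> real) \<Rightarrow> ('r \<Rightarrow> real) \<Rightarrow> 'r \<Rightarrow> real" where
  "poisson M R F G r = (let
      \<alpha> = chart_at M (proj R r);
      dF = frechet_derivative (F \<circ> darboux_inv M R \<alpha>) (at (darboux M R \<alpha> r));
      dG = frechet_derivative (G \<circ> darboux_inv M R \<alpha>) (at (darboux M R \<alpha> r))
    in \<Sum>a\<in>UNIV. dF (0, axis a 1) * dG (axis a 1, 0) - dF (axis a 1, 0) * dG (0, axis a 1))"

section \<open>Hamiltonian algebroids\<close>

text \<open>\<open>c \<alpha>\<close> is the representative over \<open>U\<^sub>\<alpha>\<close> of the 1-cocycle, and \<open>h s\<close> the Hamiltonian of the
  section \<open>s\<close>, a function on all of \<open>\<R>\<close>.\<close>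

locale hamiltonian_algebroid = lie_algebroid M A + affine_cotangent M R
  for M :: "('m::{t2_space, second_countable_topology}, 'i, 'n::finite) atlas"
    and A :: "('m, 'i, 'n, 'j::finite, 'v::real_vector) algebroid"
    and R :: "('m, 'i, 'n, 'r) affine_bundle" +
  fixes c :: "'i \<Rightarrow> ('m \<Rightarrow> 'v) \<Rightarrow> 'm \<Rightarrow> real"
    and h :: "('m \<Rightarrow> 'v) \<Rightarrow> 'r \<Rightarrow> real"
  assumes c_smooth: "s \<in> sections M A \<Longrightarrow> smooth_fun_on M (chart_dom M \<alpha>) (c \<alpha> s)"
    and c_add: "\<lbrakk>s \<in> sections M A; t \<in> sections M A; p \<in> chart_dom M \<alpha>\<rbrakk> \<Longrightarrow>
      c \<alpha> (\<lambda>q. s q + t q) p = c \<alpha> s p + c \<alpha> t p"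
    and c_scale: "\<lbrakk>s \<in> sections M A; smooth_fun M (g :: 'm \<Rightarrow> real); p \<in> chart_dom M \<alpha>\<rbrakk> \<Longrightarrow>
      c \<alpha> (\<lambda>q. g q *\<^sub>R s q) p = g p * c \<alpha> s p"
    and c_cocycle: "\<lbrakk>s \<in> sections M A; t \<in> sections M A; p \<in> chart_dom M \<alpha>\<rbrakk> \<Longrightarrow>
      c \<alpha> (bracket A s t) p =
        vf_apply M (anchor_field A s) (c \<alpha> t) p - vf_apply M (anchor_field A t) (c \<alpha> s) p"
    and hamiltonian: "\<lbrakk>s \<in> sections M A; proj R r \<in> chart_dom M \<alpha>\<rbrakk> \<Longrightarrow>
      h s r = anchor_field A s (proj R r) \<alpha> \<bullet> momenta R \<alpha> r + c \<alpha> s (proj R r)"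

section \<open>The algebra generated by ghosts and ghost momenta\<close>

text \<open>\<open>Eta j\<close> stands for the ghost \<open>\<eta>\<^sub>j\<close> and \<open>Mom j\<close> for the ghost momentum \<open>P\<^sup>j\<close>.\<close>

datatype 'j ghost = Eta 'j | Mom 'j

instance ghost :: (finite) finite
proof
  have "(UNIV :: 'a ghost set) = range Eta \<union> range Mom"
    by (metis UNIV_eq_I UnI1 UnI2 ghost.exhaust rangeI)
  then show "finite (UNIV :: 'a ghost set)"
    by (metis finite_Un finite_imageI finite)
qed

fun precedes :: "'j::linorder ghost \<Rightarrow> 'j ghost \<Rightarrow> bool" where
  "precedes (Eta i) (Eta j) \<longleftrightarrow> i < j"
| "precedes (Eta i) (Mom j) \<longleftrightarrow> True"
| "precedes (Mom i) (Eta j) \<longleftrightarrow> False"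
| "precedes (Mom i) (Mom j) \<longleftrightarrow> i < j"

text \<open>An element is given by its coefficients with respect to the monomials \<open>\<theta>\<^sub>S\<close>, the products of the
  generators in \<open>S\<close> in increasing order. The sign is that of
  \<open>\<theta>\<^sub>S \<theta>\<^sub>T = reorder_sign S T \<theta>\<^sub>S\<^sub>\<union>\<^sub>T\<close> for disjoint \<open>S\<close>, \<open>T\<close>.\<close>

definition reorder_sign :: "'j::linorder ghost set \<Rightarrow> 'j ghost set \<Rightarrow> real" where
  "reorder_sign S T = (- 1) ^ card {(a, b). a \<in> S \<and> b \<in> T \<and> precedes b a}"

typedef ('j, 'r) ghost_algebra = "UNIV :: ('j ghost set \<Rightarrow> 'r \<Rightarrow> real) set"
  morphisms coefficient Ghost_algebra ..

setup_lifting type_definition_ghost_algebra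

lemma reorder_sign_empty [simp]: "reorder_sign {} T = 1" "reorder_sign S {} = 1"
  by (simp_all add: reorder_sign_def)

lemma reorder_sign_Un_left:
  fixes S T U :: "'j::{finite, linorder} ghost set"
  assumes "S \<inter> T = {}"
  shows "reorder_sign (S \<union> T) U = reorder_sign S U * reorder_sign T U"
proof -
  have "{(a, b). a \<in> S \<union> T \<and> b \<in> U \<and> precedes b a} =
      {(a, b). a \<in> S \<and> b \<in> U \<and> precedes b a} \<union> {(a, b). a \<in> T \<and> b \<in> U \<and> precedes b a}"
    by auto
  moreover have "{(a, b). a \<in> S \<and> b \<in> U \<and> precedes b a} \<inter>
      {(a, b). a \<in> T \<and> b \<in> U \<and> precedes b a} = {}"
    using assms by auto
  ultimately show ?thesis
    by (simp add: reorder_sign_def card_Un_disjoint power_add)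
qed

lemma reorder_sign_Un_right:
  fixes S T U :: "'j::{finite, linorder} ghost set"
  assumes "T \<inter> U = {}"
  shows "reorder_sign S (T \<union> U) = reorder_sign S T * reorder_sign S U"
proof -
  have "{(a, b). a \<in> S \<and> b \<in> T \<union> U \<and> precedes b a} =
      {(a, b). a \<in> S \<and> b \<in> T \<and> precedes b a} \<union> {(a, b). a \<in> S \<and> b \<in> U \<and> precedes b a}"
    by auto
  moreover have "{(a, b). a \<in> S \<and> b \<in> T \<and> precedes b a} \<inter>
      {(a, b). a \<in> S \<and> b \<in> U \<and> precedes b a} = {}"
    using assms by auto
  ultimately show ?thesis
    by (simp add: reorder_sign_def card_Un_disjoint power_add)
qed

instantiation ghost_algebra :: ("{finite, linorder}", type) real_algebra_1
begin

lift_definition zero_ghost_algebra :: "('a, 'b) ghost_algebra" is "\<lambda>S r. 0" .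
lift_definition one_ghost_algebra :: "('a, 'b) ghost_algebra" is
  "\<lambda>S r. if S = {} then 1 else 0" .
lift_definition plus_ghost_algebra ::
  "('a, 'b) ghost_algebra \<Rightarrow> ('a, 'b) ghost_algebra \<Rightarrow> ('a, 'b) ghost_algebra" is
  "\<lambda>X Y S r. X S r + Y S r" .
lift_definition minus_ghost_algebra ::
  "('a, 'b) ghost_algebra \<Rightarrow> ('a, 'b) ghost_algebra \<Rightarrow> ('a, 'b) ghost_algebra" is
  "\<lambda>X Y S r. X S r - Y S r" .
lift_definition uminus_ghost_algebra :: "('a, 'b) ghost_algebra \<Rightarrow> ('a, 'b) ghost_algebra" is
  "\<lambda>X S r. - X S r" .
lift_definition scaleR_ghost_algebra ::
  "real \<Rightarrow> ('a, 'b) ghost_algebra \<Rightarrow> ('a, 'b) ghost_algebra" is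
  "\<lambda>x X S r. x * X S r" .
lift_definition times_ghost_algebra ::
  "('a, 'b) ghost_algebra \<Rightarrow> ('a, 'b) ghost_algebra \<Rightarrow> ('a, 'b) ghost_algebra" is
  "\<lambda>X Y S r. \<Sum>T\<in>Pow S. reorder_sign T (S - T) * X T r * Y (S - T) r" .

instance
proof
  fix X Y Z :: "('a, 'b) ghost_algebra" and x y :: real
  show "X + Y + Z = X + (Y + Z)" "X + Y = Y + X" "0 + X = X" "- X + X = 0" "X - Y = X + - Y"
    "x *\<^sub>R (X + Y) = x *\<^sub>R X + x *\<^sub>R Y" "(x + y) *\<^sub>R X = x *\<^sub>R X + y *\<^sub>R X"
    "x *\<^sub>R y *\<^sub>R X = (x * y) *\<^sub>R X" "1 *\<^sub>R X = X"
    by (transfer; simp add: algebra_simps)+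
  show "(0 :: ('a, 'b) ghost_algebra) \<noteq> 1"
    by transfer (metis zero_neq_one)
  show "(X + Y) * Z = X * Z + Y * Z" "X * (Y + Z) = X * Y + X * Z"
    by (transfer; simp add: algebra_simps sum.distrib)+
  show "x *\<^sub>R X * Y = x *\<^sub>R (X * Y)" "X * x *\<^sub>R Y = x *\<^sub>R (X * Y)"
    by (transfer; simp add: sum_distrib_left algebra_simps)+
  show "1 * X = X"
  proof (transfer, intro ext)
    fix X :: "'a ghost set \<Rightarrow> 'b \<Rightarrow> real" and S r
    have "(\<Sum>T\<in>Pow S. reorder_sign T (S - T) * (if T = {} then 1 else 0) * X (S - T) r)
        = (\<Sum>T\<in>Pow S. if T = {} then X S r else 0)"
      by (rule sum.cong) auto
    then show "(\<Sum>T\<in>Pow S. reorder_sign T (S - T) * (if T = {} then 1 else 0) * X (S - T) r)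
        = X S r"
      by simp
  qed
  show "X * 1 = X"
  proof (transfer, intro ext)
    fix X :: "'a ghost set \<Rightarrow> 'b \<Rightarrow> real" and S r
    have "(\<Sum>T\<in>Pow S. reorder_sign T (S - T) * X T r * (if S - T = {} then 1 else 0))
        = (\<Sum>T\<in>Pow S. if T = S then X S r else 0)"
      by (rule sum.cong) auto
    then show "(\<Sum>T\<in>Pow S. reorder_sign T (S - T) * X T r * (if S - T = {} then 1 else 0))
        = X S r"
      by simp
  qed
  show "X * Y * Z = X * (Y * Z)"
  proof (transfer, intro ext)
    fix X Y Z :: "'a ghost set \<Rightarrow> 'b \<Rightarrow> real" and S r
    let ?s = "reorder_sign :: 'a ghost set \<Rightarrow> _"
    have "(\<Sum>T\<in>Pow S. ?s T (S - T) * (\<Sum>U\<in>Pow T. ?s U (T - U) * X U r * Y (T - U) r) * Z (S - T) r)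
      = (\<Sum>(T, U)\<in>Sigma (Pow S) Pow.
          ?s T (S - T) * ?s U (T - U) * X U r * Y (T - U) r * Z (S - T) r)"
      by (simp add: sum.Sigma[symmetric] sum_distrib_left sum_distrib_right mult.assoc)
    also have "\<dots> = (\<Sum>(U, V)\<in>Sigma (Pow S) (\<lambda>U. Pow (S - U)).
          ?s U (S - U) * ?s V (S - U - V) * X U r * Y V r * Z (S - U - V) r)"
    proof (rule sum.reindex_bij_witness[where i = "\<lambda>(U, V). (U \<union> V, U)" and j = "\<lambda>(T, U). (U, T - U)"],
        goal_cases)
      case (5 TU)
      then obtain T U where TU: "TU = (T, U)" "U \<subseteq> T" "T \<subseteq> S"
        by auto
      have *: "T = U \<union> (T - U)" "S - U = (T - U) \<union> (S - T)" "S - U - (T - U) = S - T"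
        using TU by auto
      have "?s T (S - T) = ?s U (S - T) * ?s (T - U) (S - T)"
        by (subst *(1), rule reorder_sign_Un_left) auto
      moreover have "?s U (S - U) = ?s U (T - U) * ?s U (S - T)"
        by (subst *(2), rule reorder_sign_Un_right) auto
      ultimately show ?case
        by (simp add: TU *(3))
    qed auto
    also have "\<dots> = (\<Sum>U\<in>Pow S. ?s U (S - U) * X U r *
        (\<Sum>V\<in>Pow (S - U). ?s V (S - U - V) * Y V r * Z (S - U - V) r))"
      by (simp add: sum.Sigma[symmetric] sum_distrib_left mult_ac)
    finally show "(\<Sum>T\<in>Pow S. ?s T (S - T) * (\<Sum>U\<in>Pow T. ?s U (T - U) * X U r * Y (T - U) r)
        * Z (S - T) r) = (\<Sum>U\<in>Pow S. ?s U (S - U) * X U r *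
        (\<Sum>V\<in>Pow (S - U). ?s V (S - U - V) * Y V r * Z (S - U - V) r))" .
  qed
qed

end

lift_definition of_fun :: "('r \<Rightarrow> real) \<Rightarrow> ('j, 'r) ghost_algebra" is
  "\<lambda>g S r. if S = {} then g r else 0" .

lift_definition generator :: "'j ghost \<Rightarrow> ('j, 'r) ghost_algebra" is
  "\<lambda>a S r. if S = {a} then 1 else 0" .

abbreviation eta :: "'j \<Rightarrow> ('j, 'r) ghost_algebra" where
  "eta j \<equiv> generator (Eta j)"

abbreviation mom :: "'j \<Rightarrow> ('j, 'r) ghost_algebra" where
  "mom j \<equiv> generator (Mom j)"

definition BFV :: "('m, 'i, 'n::finite) atlas \<Rightarrow> ('m, 'i, 'n, 'r) affine_bundle
    \<Rightarrow> ('j, 'r) ghost_algebra set" where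
  "BFV M R = {X. \<forall>S. smooth_total M R (coefficient X S)}"

definition support :: "('j, 'r) ghost_algebra \<Rightarrow> 'j ghost set set" where
  "support X = {S. coefficient X S \<noteq> (\<lambda>r. 0)}"

text \<open>The parity \<open>p\<close> only matters modulo 2; the zero element has every parity and every ghost
  number.\<close>

definition has_parity :: "nat \<Rightarrow> ('j, 'r) ghost_algebra \<Rightarrow> bool" where
  "has_parity p X \<longleftrightarrow> (\<forall>S \<in> support X. even (card S) = even p)"

definition has_ghost_number :: "int \<Rightarrow> ('j, 'r) ghost_algebra \<Rightarrow> bool" where
  "has_ghost_number n X \<longleftrightarrow>
     (\<forall>S \<in> support X. int (card (S \<inter> range Eta)) - int (card (S \<inter> range Mom)) = n)"

definition bfv_rank :: "('j::finite, 'r) ghost_algebra \<Rightarrow> nat" where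
  "bfv_rank X = Max (insert 0 ((\<lambda>S. card (S \<inter> range Mom)) ` support X))"

text \<open>\<open>B\<close> is a graded Poisson bracket (bilinear, graded antisymmetric, graded Jacobi and Leibniz) that
  extends the bracket of \<open>\<R>\<close>. The rules on functions and generators together with
  bilinearity and the Leibniz rules determine \<open>B\<close> on \<open>BFV M R\<close>.\<close>

locale bfv_bracket =
  fixes M :: "('m, 'i, 'n::finite) atlas"
    and R :: "('m, 'i, 'n, 'r) affine_bundle"
    and B :: "('j::{finite, linorder}, 'r) ghost_algebra \<Rightarrow> ('j, 'r) ghost_algebra
               \<Rightarrow> ('j, 'r) ghost_algebra"
  assumes closed: "\<lbrakk>X \<in> BFV M R; Y \<in> BFV M R\<rbrakk> \<Longrightarrow> B X Y \<in> BFV M R"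
    and add_left: "\<lbrakk>X \<in> BFV M R; X' \<in> BFV M R; Y \<in> BFV M R\<rbrakk> \<Longrightarrow> B (X + X') Y = B X Y + B X' Y"
    and add_right: "\<lbrakk>X \<in> BFV M R; Y \<in> BFV M R; Y' \<in> BFV M R\<rbrakk> \<Longrightarrow> B X (Y + Y') = B X Y + B X Y'"
    and scale_left: "\<lbrakk>X \<in> BFV M R; Y \<in> BFV M R\<rbrakk> \<Longrightarrow> B (a *\<^sub>R X) Y = a *\<^sub>R B X Y"
    and scale_right: "\<lbrakk>X \<in> BFV M R; Y \<in> BFV M R\<rbrakk> \<Longrightarrow> B X (a *\<^sub>R Y) = a *\<^sub>R B X Y"
    and antisym: "\<lbrakk>X \<in> BFV M R; Y \<in> BFV M R; has_parity p X; has_parity q Y\<rbrakk> \<Longrightarrow>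
      B X Y = - ((- 1) ^ (p * q) * B Y X)"
    and jacobi: "\<lbrakk>X \<in> BFV M R; Y \<in> BFV M R; Z \<in> BFV M R; has_parity p X; has_parity q Y\<rbrakk> \<Longrightarrow>
      B X (B Y Z) = B (B X Y) Z + (- 1) ^ (p * q) * B Y (B X Z)"
    and leibniz_left:
      "\<lbrakk>X \<in> BFV M R; Y \<in> BFV M R; Z \<in> BFV M R; has_parity q Y; has_parity s Z\<rbrakk> \<Longrightarrow>
      B (X * Y) Z = X * B Y Z + (- 1) ^ (q * s) * B X Z * Y"
    and leibniz_right:
      "\<lbrakk>X \<in> BFV M R; Y \<in> BFV M R; Z \<in> BFV M R; has_parity p X; has_parity q Y\<rbrakk> \<Longrightarrow>
      B X (Y * Z) = B X Y * Z + (- 1) ^ (p * q) * Y * B X Z"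
    and fun_fun: "\<lbrakk>smooth_total M R F; smooth_total M R G\<rbrakk> \<Longrightarrow>
      B (of_fun F) (of_fun G) = of_fun (poisson M R F G)"
    and eta_mom: "B (eta j) (mom k) = (if j = k then 1 else 0)"
      "B (mom k) (eta j) = (if j = k then 1 else 0)"
    and eta_eta: "B (eta j) (eta k) = 0"
    and mom_mom: "B (mom j) (mom k) = 0"
    and generator_fun: "smooth_total M R F \<Longrightarrow> B (eta j) (of_fun F) = 0"
      "smooth_total M R F \<Longrightarrow> B (mom j) (of_fun F) = 0"

section \<open>BRST operators\<close>

definition brst_op ::
    "(('j, 'r) ghost_algebra \<Rightarrow> ('j, 'r) ghost_algebra \<Rightarrow> ('j, 'r) ghost_algebra)
      \<Rightarrow> ('j, 'r) ghost_algebra \<Rightarrow> ('j, 'r) ghost_algebra \<Rightarrow> ('j, 'r) ghost_algebra" where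
  "brst_op B \<Omega> \<psi> = B \<psi> \<Omega>"

text \<open>\<open>\<Omega> = \<Sum>\<^sub>j \<eta>\<^sub>j h\<^sup>j + \<onehalf> \<Sum>\<^sub>i\<^sub>j\<^sub>k f\<^sup>j\<^sup>k\<^sub>i \<eta>\<^sub>k \<eta>\<^sub>j P\<^sup>i\<close>; note the order of the two ghosts.\<close>

definition brst_charge ::
    "('m, 'i, 'n::finite, 'r) affine_bundle \<Rightarrow> ('j \<Rightarrow> 'r \<Rightarrow> real)
      \<Rightarrow> ('j \<Rightarrow> 'j \<Rightarrow> 'j \<Rightarrow> 'm \<Rightarrow> real) \<Rightarrow> ('j::{finite, linorder}, 'r) ghost_algebra" where
  "brst_charge R H f =
     (\<Sum>j\<in>UNIV. eta j * of_fun (H j)) +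
     (1 / 2) *\<^sub>R (\<Sum>i\<in>UNIV. \<Sum>j\<in>UNIV. \<Sum>k\<in>UNIV.
        of_fun (f j k i \<circ> proj R) * eta k * eta j * mom i)"

text \<open>\<open>\<Omega>\<close> generates a BRST operator: \<open>\<Omega>\<close> is odd with the prescribed terms of order at most one in
  the ghost momenta, and \<open>{\<cdot>, \<Omega>}\<close> is a nilpotent operator of ghost number one.\<close>

definition generates_brst ::
    "('m, 'i, 'n::finite) atlas \<Rightarrow> ('m, 'i, 'n, 'r) affine_bundle
      \<Rightarrow> (('j::{finite, linorder}, 'r) ghost_algebra \<Rightarrow> ('j, 'r) ghost_algebra
            \<Rightarrow> ('j, 'r) ghost_algebra)
      \<Rightarrow> ('j \<Rightarrow> 'r \<Rightarrow> real) \<Rightarrow> ('j \<Rightarrow> 'j \<Rightarrow> 'j \<Rightarrow> 'm \<Rightarrow> real) \<Rightarrow> ('j, 'r) ghost_algebra \<Rightarrow> bool" where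
  "generates_brst M R B H f \<Omega> \<longleftrightarrow>
     \<Omega> \<in> BFV M R \<and> has_parity 1 \<Omega> \<and>
     (\<exists>Z \<in> BFV M R. (\<forall>S \<in> support Z. 2 \<le> card (S \<inter> range Mom)) \<and> \<Omega> = brst_charge R H f + Z) \<and>
     (\<forall>\<psi> \<in> BFV M R. \<forall>n. has_ghost_number n \<psi> \<longrightarrow> has_ghost_number (n + 1) (brst_op B \<Omega> \<psi>)) \<and>
     (\<forall>\<psi> \<in> BFV M R. brst_op B \<Omega> (brst_op B \<Omega> \<psi>) = 0)"

end

theory Submission
  imports Defs
begin

text \<open>
  Write \<open>\<Omega> = \<Sum> \<eta>\<^sub>l h\<^sup>l + \<Sum> u\<^sub>i P\<^sup>i\<close> with \<open>u\<^sub>i = \<onehalf> \<Sum> f\<^sup>j\<^sup>k\<^sub>i \<eta>\<^sub>k \<eta>\<^sub>j\<close>, the component of \<open>\<onehalf> \<lfloor>\<eta>, \<eta>'\<rfloor>\<close> along the basis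
  element \<open>e\<^sup>i\<close>. As \<open>\<Omega>\<close> is odd, \<open>D = {\<Omega>, \<cdot>}\<close> is an odd derivation, so \<open>{\<Omega>, \<Omega>} = D \<Omega>\<close> follows from
  the values of \<open>D\<close> on generators and functions:
  \<open>D \<eta>\<^sub>l = u\<^sub>l\<close>,  \<open>D P\<^sup>l = h\<^sup>l - \<Sum> f\<^sup>l\<^sup>k\<^sub>i \<eta>\<^sub>k P\<^sup>i\<close>,  \<open>D f = \<Sum> \<eta>\<^sub>l \<delta>\<^sub>l f\<close> for functions \<open>f\<close> on the base, and
  \<open>D h\<^sup>l = \<Sum> f\<^sup>j\<^sup>l\<^sub>i \<eta>\<^sub>j h\<^sup>i - \<onehalf> \<Sum> (\<delta>\<^sub>l f\<^sup>j\<^sup>k\<^sub>i) \<eta>\<^sub>k \<eta>\<^sub>j P\<^sup>i\<close>.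

  In \<open>D \<Omega>\<close> the terms without ghost momenta are multiples of \<open>\<Sum> f\<^sup>j\<^sup>k\<^sub>i h\<^sup>i \<eta>\<^sub>k \<eta>\<^sub>j\<close>, with coefficients
  \<open>\<onehalf> - 1 + \<onehalf> = 0\<close>; this uses that the Hamiltonians represent the bracket, \<open>{h\<^sup>j, h\<^sup>k} = \<Sum> f\<^sup>j\<^sup>k\<^sub>i h\<^sup>i\<close>. In
  the terms linear in the momenta, \<open>P\<^sup>i\<close> is multiplied by
  \<open>\<Sum> (\<delta>\<^sub>l f\<^sup>j\<^sup>k\<^sub>i + \<Sum>\<^sub>m f\<^sup>j\<^sup>k\<^sub>m f\<^sup>l\<^sup>m\<^sub>i) \<eta>\<^sub>l \<eta>\<^sub>k \<eta>\<^sub>j\<close>. The cubic monomials are invariant under cyclic permutations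
  of \<open>l, j, k\<close>, so only the cyclic sum of the bracketed coefficient matters, and that is the
  \<open>e\<^sup>i\<close>-component of the Jacobi identity for \<open>\<lfloor>e\<^sup>l, \<lfloor>e\<^sup>j, e\<^sup>k\<rfloor>\<rfloor>\<close>: the derivatives of the structure functions
  come from the Leibniz rule of the algebroid. No quadratic terms arise, since functions on the base
  Poisson-commute. Hence no corrections of higher order in the momenta are needed
  (\<open>structure_jacobi\<close>, \<open>structure_identity\<close>, \<open>charge_charge\<close>).

  The graded Jacobi identity turns \<open>{\<Omega>, \<Omega>} = 0\<close> into \<open>Q\<^sup>2 = 0\<close>. To apply it one has to know that
  brackets add ghost numbers and hence parities; this follows from the Leibniz rules, because the
  bracket of any two functions or generators has the right ghost number
  (\<open>bracket_ghost_number\<close>, \<open>nilpotent\<close>). The rank is one as soon as some structure function is nonzero,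
  since the structure functions can be recovered from the cubic term by bracketing it with a ghost
  and a ghost momentum (\<open>bfv_rank_eq\<close>).
\<close>

section \<open>Calculus of smooth maps on open sets\<close>

lemma frechet_derivative_cong_open:
  assumes "open S" "x \<in> S" "\<And>y. y \<in> S \<Longrightarrow> f y = g y"
  shows "frechet_derivative f (at x) = frechet_derivative g (at x)"
proof -
  have "(f has_derivative D) (at x) \<longleftrightarrow> (g has_derivative D) (at x)" for D
    using assms has_derivative_transform_within_open[of f D x UNIV S g]
      has_derivative_transform_within_open[of g D x UNIV S f] by auto
  then show ?thesis
    by (simp add: frechet_derivative_def)
qed

lemma differentiable_on_open_cong:
  assumes "open S" "\<And>x. x \<in> S \<Longrightarrow> f x = g x" "f differentiable_on S"
  shows "g differentiable_on S"
  using assms unfolding differentiable_on_def differentiable_def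
  by (metis has_derivative_transform)

lemma Ck_on_cong:
  assumes "open S" "\<And>x. x \<in> S \<Longrightarrow> f x = g x" "Ck_on k S f"
  shows "Ck_on k S g"
  using assms(2,3)
proof (induction k arbitrary: f g)
  case 0
  then show ?case
    using continuous_on_cong by force
next
  case (Suc k)
  have "Ck_on k S (\<lambda>x. frechet_derivative g (at x) v)" for v
    using Suc.IH[of "\<lambda>x. frechet_derivative f (at x) v" "\<lambda>x. frechet_derivative g (at x) v"]
      Suc.prems frechet_derivative_cong_open[OF assms(1), of _ f g] by auto
  then show ?case
    using Suc.prems differentiable_on_open_cong[OF assms(1), of f g] by auto
qed

lemma Ck_on_SucD: "Ck_on (Suc k) S f \<Longrightarrow> Ck_on k S f"
proof (induction k arbitrary: f)
  case 0
  then show ?case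
    by (simp add: differentiable_imp_continuous_on)
next
  case (Suc k)
  then show ?case
    by (metis Ck_on.simps(2))
qed

lemma Ck_on_subset:
  assumes "Ck_on k S f" "T \<subseteq> S"
  shows "Ck_on k T f"
  using assms(1)
proof (induction k arbitrary: f)
  case 0
  then show ?case
    using assms(2) continuous_on_subset by auto
next
  case (Suc k)
  then show ?case
    using assms(2) differentiable_on_subset by auto
qed

lemma Ck_on_Suc_derivative:
  assumes "open S" "Ck_on (Suc k) S f" "x \<in> S"
  shows "(f has_derivative frechet_derivative f (at x)) (at x)"
  using assms by (simp add: differentiable_on_eq_differentiable_at frechet_derivative_works[symmetric])

text \<open>The induction step behind all closure properties: derivatives at points of an open set are unique,
  so it suffices to exhibit one whose directional values are \<open>C\<^sup>k\<close>.\<close>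

lemma Ck_on_SucI:
  assumes "open S" "\<And>x. x \<in> S \<Longrightarrow> (f has_derivative D x) (at x)"
    "\<And>v. Ck_on k S (\<lambda>x. D x v)"
  shows "Ck_on (Suc k) S f"
proof -
  have "frechet_derivative f (at x) = D x" if "x \<in> S" for x
    using assms(2)[OF that] by (metis frechet_derivative_at)
  then have "Ck_on k S (\<lambda>x. frechet_derivative f (at x) v)" for v
    by (intro Ck_on_cong[OF assms(1) _ assms(3)[of v]]) simp
  moreover have "f differentiable_on S"
    using assms(1,2) by (auto simp: differentiable_on_eq_differentiable_at differentiable_def)
  ultimately show ?thesis by simp
qed

lemma Ck_on_const: "open S \<Longrightarrow> Ck_on k S (\<lambda>x. c)"
proof (induction k arbitrary: c)
  case (Suc k)
  show ?case
    by (rule Ck_on_SucI[OF Suc.prems, where D = "\<lambda>x v. 0"]) (auto intro: Suc)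
qed simp

lemma Ck_on_linear: "\<lbrakk>open S; bounded_linear L\<rbrakk> \<Longrightarrow> Ck_on k S L"
proof (induction k)
  case 0
  then show ?case
    by (simp add: linear_continuous_on)
next
  case (Suc k)
  show ?case
    by (rule Ck_on_SucI[OF Suc.prems(1), where D = "\<lambda>x. L"])
      (auto intro: Ck_on_const Suc.prems bounded_linear_imp_has_derivative)
qed

lemma Ck_on_add: "\<lbrakk>open S; Ck_on k S f; Ck_on k S g\<rbrakk> \<Longrightarrow> Ck_on k S (\<lambda>x. f x + g x)"
proof (induction k arbitrary: f g)
  case 0
  then show ?case
    by (simp add: continuous_on_add)
next
  case (Suc k)
  show ?case
  proof (rule Ck_on_SucI[OF Suc.prems(1)])
    fix x assume "x \<in> S"
    then show "((\<lambda>x. f x + g x) has_derivative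
        (\<lambda>v. frechet_derivative f (at x) v + frechet_derivative g (at x) v)) (at x)"
      using Suc.prems by (intro has_derivative_add Ck_on_Suc_derivative)
  qed (use Suc.prems in \<open>auto intro!: Suc.IH\<close>)
qed

lemma (in bounded_bilinear) Ck_on_prod:
  "\<lbrakk>open S; Ck_on k S f; Ck_on k S g\<rbrakk> \<Longrightarrow> Ck_on k S (\<lambda>x. prod (f x) (g x))"
proof (induction k arbitrary: f g)
  case 0
  then show ?case
    by (simp add: continuous_on)
next
  case (Suc k)
  show ?case
  proof (rule Ck_on_SucI[OF Suc.prems(1)])
    fix x assume "x \<in> S"
    then show "((\<lambda>x. prod (f x) (g x)) has_derivative
        (\<lambda>v. prod (f x) (frechet_derivative g (at x) v)
           + prod (frechet_derivative f (at x) v) (g x))) (at x)"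
      using Suc.prems by (intro FDERIV Ck_on_Suc_derivative)
  next
    fix v
    show "Ck_on k S (\<lambda>x. prod (f x) (frechet_derivative g (at x) v)
           + prod (frechet_derivative f (at x) v) (g x))"
      using Suc.prems Ck_on_SucD[OF Suc.prems(2)] Ck_on_SucD[OF Suc.prems(3)]
      by (intro Ck_on_add Suc.IH) auto
  qed
qed

lemma Ck_on_linear_compose:
  "\<lbrakk>open S; bounded_linear L; Ck_on k S f\<rbrakk> \<Longrightarrow> Ck_on k S (\<lambda>x. L (f x))"
proof (induction k arbitrary: f)
  case 0
  then show ?case
    unfolding Ck_on.simps by (metis bounded_linear.continuous_on)
next
  case (Suc k)
  show ?case
  proof (rule Ck_on_SucI[OF Suc.prems(1)])
    fix x assume "x \<in> S"
    then show "((\<lambda>x. L (f x)) has_derivative (\<lambda>v. L (frechet_derivative f (at x) v))) (at x)"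
      using bounded_linear.has_derivative[OF Suc.prems(2) Ck_on_Suc_derivative] Suc.prems by blast
  qed (use Suc.prems in \<open>auto intro!: Suc.IH\<close>)
qed

lemma Ck_on_compose_linear:
  "\<lbrakk>open S; open T; bounded_linear L; L ` T \<subseteq> S; Ck_on k S f\<rbrakk> \<Longrightarrow> Ck_on k T (\<lambda>x. f (L x))"
proof (induction k arbitrary: f)
  case 0
  then show ?case
    unfolding Ck_on.simps by (metis continuous_on_compose2 linear_continuous_on)
next
  case (Suc k)
  show ?case
  proof (rule Ck_on_SucI[OF Suc.prems(2)])
    fix x assume "x \<in> T"
    then have "(f has_derivative frechet_derivative f (at (L x))) (at (L x))"
      using Suc.prems by (intro Ck_on_Suc_derivative) auto
    then show "((\<lambda>x. f (L x)) has_derivative (\<lambda>v. frechet_derivative f (at (L x)) (L v))) (at x)"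
      using has_derivative_compose[OF bounded_linear_imp_has_derivative[OF Suc.prems(3)]] by auto
  next
    fix v
    have "Ck_on k S (\<lambda>y. frechet_derivative f (at y) (L v))"
      using Suc.prems(5) by simp
    then show "Ck_on k T (\<lambda>x. frechet_derivative f (at (L x)) (L v))"
      using Suc.IH Suc.prems(1-4) by blast
  qed
qed

lemma smooth_on_cong: "\<lbrakk>open S; \<And>x. x \<in> S \<Longrightarrow> f x = g x; smooth_on S f\<rbrakk> \<Longrightarrow> smooth_on S g"
  unfolding smooth_on_def using Ck_on_cong by blast

lemma smooth_on_subset: "\<lbrakk>smooth_on S f; T \<subseteq> S\<rbrakk> \<Longrightarrow> smooth_on T f"
  unfolding smooth_on_def using Ck_on_subset by blast

lemma smooth_on_const: "open S \<Longrightarrow> smooth_on S (\<lambda>x. c)"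
  unfolding smooth_on_def using Ck_on_const by blast

lemma smooth_on_linear: "\<lbrakk>open S; bounded_linear L\<rbrakk> \<Longrightarrow> smooth_on S L"
  unfolding smooth_on_def using Ck_on_linear by blast

lemma smooth_on_add: "\<lbrakk>open S; smooth_on S f; smooth_on S g\<rbrakk> \<Longrightarrow> smooth_on S (\<lambda>x. f x + g x)"
  unfolding smooth_on_def using Ck_on_add by blast

lemma smooth_on_mult:
  fixes f g :: "'a::real_normed_vector \<Rightarrow> real"
  shows "\<lbrakk>open S; smooth_on S f; smooth_on S g\<rbrakk> \<Longrightarrow> smooth_on S (\<lambda>x. f x * g x)"
  unfolding smooth_on_def using bounded_bilinear.Ck_on_prod[OF bounded_bilinear_mult] by blast

lemma smooth_on_inner:
  "\<lbrakk>open S; smooth_on S f; smooth_on S g\<rbrakk> \<Longrightarrow> smooth_on S (\<lambda>x. f x \<bullet> g x)"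
  unfolding smooth_on_def using bounded_bilinear.Ck_on_prod[OF bounded_bilinear_inner] by blast

lemma smooth_on_linear_compose:
  "\<lbrakk>open S; bounded_linear L; smooth_on S f\<rbrakk> \<Longrightarrow> smooth_on S (\<lambda>x. L (f x))"
  unfolding smooth_on_def using Ck_on_linear_compose by blast

lemma smooth_on_compose_linear:
  "\<lbrakk>open S; open T; bounded_linear L; L ` T \<subseteq> S; smooth_on S f\<rbrakk> \<Longrightarrow> smooth_on T (\<lambda>x. f (L x))"
  unfolding smooth_on_def using Ck_on_compose_linear by blast

lemma smooth_on_sum:
  "\<lbrakk>open S; \<And>i. i \<in> I \<Longrightarrow> smooth_on S (f i)\<rbrakk> \<Longrightarrow> smooth_on S (\<lambda>x. \<Sum>i\<in>I. f i x)"
  by (induction I rule: infinite_finite_induct) (auto intro: smooth_on_const smooth_on_add)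

lemma smooth_on_has_derivative:
  "\<lbrakk>open S; smooth_on S f; x \<in> S\<rbrakk> \<Longrightarrow> (f has_derivative frechet_derivative f (at x)) (at x)"
  unfolding smooth_on_def using Ck_on_Suc_derivative by blast

lemma smooth_on_directional:
  "smooth_on S f \<Longrightarrow> smooth_on S (\<lambda>x. frechet_derivative f (at x) v)"
  unfolding smooth_on_def using Ck_on.simps(2) by blast

section \<open>Functions and vector fields on a manifold\<close>

lemma linear_axis_expansion:
  fixes L :: "real ^ 'n::finite \<Rightarrow> real"
  assumes "linear L"
  shows "L w = (\<Sum>a\<in>UNIV. w $ a * L (axis a 1))"
proof -
  have "L w = L (\<Sum>a\<in>UNIV. w $ a *\<^sub>R axis a 1)"
    by (metis (no_types) basis_expansion scalar_mult_eq_scaleR)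
  then show ?thesis
    by (simp add: linear_sum[OF assms] linear_scale[OF assms])
qed

context smooth_manifold
begin

lemma chart_inv_chart [simp]: "p \<in> chart_dom M \<alpha> \<Longrightarrow> chart_inv M \<alpha> (chart M \<alpha> p) = p"
  using chart_homeo[of \<alpha>] by (simp add: homeomorphism_def)

lemma chart_at_in: "p \<in> chart_dom M (chart_at M p)"
  using cover unfolding chart_at_def by (metis UNIV_I UN_iff someI_ex)

lemma open_chart_image: "open W \<Longrightarrow> open (chart M \<alpha> ` (chart_dom M \<alpha> \<inter> W))"
  using homeomorphism_imp_open_map[OF chart_homeo[of \<alpha>], of "chart_dom M \<alpha> \<inter> W"]
    open_image[of \<alpha>] open_dom[of \<alpha>]
  by (metis openin_open_Int openin_open_eq openin_open)

lemma smooth_fun_on_mono: "\<lbrakk>smooth_fun_on M W f; V \<subseteq> W\<rbrakk> \<Longrightarrow> smooth_fun_on M V f"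
  unfolding smooth_fun_on_def by (meson Int_mono image_mono order_refl smooth_on_subset)

lemma smooth_fun_on_cong:
  assumes "open W" "\<And>p. p \<in> W \<Longrightarrow> f p = g p" "smooth_fun_on M W f"
  shows "smooth_fun_on M W g"
  unfolding smooth_fun_on_def
proof
  fix \<alpha>
  show "smooth_on (chart M \<alpha> ` (chart_dom M \<alpha> \<inter> W)) (g \<circ> chart_inv M \<alpha>)"
    by (rule smooth_on_cong[OF open_chart_image[OF assms(1)], where f = "f \<circ> chart_inv M \<alpha>"])
      (use assms in \<open>auto simp: smooth_fun_on_def\<close>)
qed

lemma smooth_fun_on_const: "open W \<Longrightarrow> smooth_fun_on M W (\<lambda>p. c)"
  unfolding smooth_fun_on_def comp_def by (simp add: smooth_on_const open_chart_image)

lemma smooth_fun_on_add: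
  "\<lbrakk>open W; smooth_fun_on M W f; smooth_fun_on M W g\<rbrakk> \<Longrightarrow> smooth_fun_on M W (\<lambda>p. f p + g p)"
  unfolding smooth_fun_on_def comp_def by (simp add: smooth_on_add open_chart_image)

lemma smooth_fun_on_mult:
  fixes f g :: "'m \<Rightarrow> real"
  shows "\<lbrakk>open W; smooth_fun_on M W f; smooth_fun_on M W g\<rbrakk> \<Longrightarrow> smooth_fun_on M W (\<lambda>p. f p * g p)"
  unfolding smooth_fun_on_def comp_def by (simp add: smooth_on_mult open_chart_image)

lemma smooth_fun_on_sum:
  "\<lbrakk>open W; \<And>i. i \<in> I \<Longrightarrow> smooth_fun_on M W (f i)\<rbrakk> \<Longrightarrow> smooth_fun_on M W (\<lambda>p. \<Sum>i\<in>I. f i p)"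
  by (induction I rule: infinite_finite_induct) (auto intro: smooth_fun_on_const smooth_fun_on_add)

text \<open>Independence of the chart is the chain rule for the transition map, whose derivative is the
  Jacobian by which the components of the vector field transform.\<close>

lemma vf_apply_eq:
  assumes v: "vector_field M v" and f: "smooth_fun M f" and p: "p \<in> chart_dom M \<alpha>"
  shows "vf_apply M v f p =
    frechet_derivative (f \<circ> chart_inv M \<alpha>) (at (chart M \<alpha> p)) (v p \<alpha>)"
proof -
  define \<beta> where "\<beta> = chart_at M p"
  define U where "U = chart M \<beta> ` (chart_dom M \<beta> \<inter> chart_dom M \<alpha>)"
  let ?x = "chart M \<beta> p" and ?\<tau> = "transition M \<beta> \<alpha>"
  have p\<beta>: "p \<in> chart_dom M \<beta>"
    unfolding \<beta>_def by (rule chart_at_in)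
  have U: "open U" "?x \<in> U"
    using p p\<beta> open_chart_image[OF open_dom] by (auto simp: U_def)
  have \<tau>x: "?\<tau> ?x = chart M \<alpha> p"
    using p\<beta> by (simp add: transition_def)
  have "(?\<tau> has_derivative jacobian M \<beta> \<alpha> p) (at ?x)"
    using smooth_on_has_derivative[OF U(1) smooth_transition[of \<beta> \<alpha>, folded U_def] U(2)]
    by (simp add: jacobian_def)
  moreover have "(f \<circ> chart_inv M \<alpha> has_derivative
      frechet_derivative (f \<circ> chart_inv M \<alpha>) (at (chart M \<alpha> p))) (at (?\<tau> ?x))"
    unfolding \<tau>x using f p
    by (intro smooth_on_has_derivative[OF open_image[of \<alpha>]]) (auto simp: smooth_fun_on_def)
  ultimately have "((\<lambda>z. (f \<circ> chart_inv M \<alpha>) (?\<tau> z)) has_derivative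
      (\<lambda>u. frechet_derivative (f \<circ> chart_inv M \<alpha>) (at (chart M \<alpha> p)) (jacobian M \<beta> \<alpha> p u))) (at ?x)"
    by (rule has_derivative_compose)
  moreover have "(f \<circ> chart_inv M \<alpha>) (?\<tau> z) = (f \<circ> chart_inv M \<beta>) z" if "z \<in> U" for z
    using that by (auto simp: U_def transition_def)
  ultimately have "(f \<circ> chart_inv M \<beta> has_derivative
      (\<lambda>u. frechet_derivative (f \<circ> chart_inv M \<alpha>) (at (chart M \<alpha> p)) (jacobian M \<beta> \<alpha> p u))) (at ?x)"
    using has_derivative_transform_within_open[OF _ U] by blast
  then have "frechet_derivative (f \<circ> chart_inv M \<beta>) (at ?x) =
      (\<lambda>u. frechet_derivative (f \<circ> chart_inv M \<alpha>) (at (chart M \<alpha> p)) (jacobian M \<beta> \<alpha> p u))"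
    by (rule frechet_derivative_at[symmetric])
  moreover have "v p \<alpha> = jacobian M \<beta> \<alpha> p (v p \<beta>)"
    using v p p\<beta> unfolding vector_field_def tangent_at_def by blast
  ultimately show ?thesis
    by (simp add: vf_apply_def \<beta>_def[symmetric] Let_def)
qed

text \<open>The definition of \<^const>\<open>vf_apply\<close> chooses a chart at each point separately. As the choice is
  immaterial, one chart serves for its whole domain, where the function is \<open>\<Sum> v\<^sub>a \<partial>\<^sub>a f\<close>.\<close>

lemma smooth_vf_apply:
  assumes v: "vector_field M v" and f: "smooth_fun M f"
  shows "smooth_fun M (vf_apply M v f)"
  unfolding smooth_fun_on_def
proof
  fix \<alpha>
  define U where "U = chart M \<alpha> ` chart_dom M \<alpha>"
  let ?f = "f \<circ> chart_inv M \<alpha>" and ?v = "(\<lambda>p. v p \<alpha>) \<circ> chart_inv M \<alpha>"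
  have U: "open U"
    using open_image by (simp add: U_def)
  have sm: "smooth_on U ?f" "smooth_on U ?v"
    using f v by (auto simp: U_def smooth_fun_on_def vector_field_def dest!: spec[of _ \<alpha>])
  have "smooth_on U (\<lambda>x. ?v x $ a)" for a
    using smooth_on_linear_compose[OF U bounded_linear_vec_nth sm(2)] .
  then have "smooth_on U (\<lambda>x. \<Sum>a\<in>UNIV. ?v x $ a * frechet_derivative ?f (at x) (axis a 1))"
    by (intro smooth_on_sum smooth_on_mult U smooth_on_directional sm)
  moreover have "(\<Sum>a\<in>UNIV. ?v x $ a * frechet_derivative ?f (at x) (axis a 1)) =
      (vf_apply M v f \<circ> chart_inv M \<alpha>) x" if x: "x \<in> U" for x
  proof -
    obtain p where p: "p \<in> chart_dom M \<alpha>" "x = chart M \<alpha> p"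
      using x by (auto simp: U_def)
    have lin: "linear (frechet_derivative ?f (at x))"
      using smooth_on_has_derivative[OF U sm(1) x] has_derivative_linear by blast
    then have "frechet_derivative ?f (at x) (v p \<alpha>) =
        (\<Sum>a\<in>UNIV. v p \<alpha> $ a * frechet_derivative ?f (at x) (axis a 1))"
      by (rule linear_axis_expansion)
    then show ?thesis
      using p by (simp add: vf_apply_eq[OF v f])
  qed
  ultimately have "smooth_on U (vf_apply M v f \<circ> chart_inv M \<alpha>)"
    by (rule smooth_on_cong[OF U, rotated])
  then show "smooth_on (chart M \<alpha> ` (chart_dom M \<alpha> \<inter> UNIV)) (vf_apply M v f \<circ> chart_inv M \<alpha>)"
    by (simp add: U_def)
qed

end

section \<open>Sections of a Lie algebroid and its structure functions\<close>

context vector_bundle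
begin

lemma section_in_span:
  assumes "s \<in> sections M A" "(W, b) \<in> local_frames A" "p \<in> W"
  shows "s p \<in> span (range (\<lambda>j. b j p))"
  using assms frame_basis[OF assms(2,3)] by (simp add: sections_def)

lemma subspace_fibre: "subspace (fibre A p)"
proof -
  obtain W b where "(W, b) \<in> local_frames A" "p \<in> W"
    using frame_cover[unfolded set_eq_iff, THEN spec, of p] by auto
  then show ?thesis
    using frame_basis subspace_span by metis
qed

lemma section_smooth_coeff:
  "\<lbrakk>s \<in> sections M A; (W, b) \<in> local_frames A\<rbrakk> \<Longrightarrow>
    smooth_fun_on M W (\<lambda>p. frame_coeff b p (s p) k)"
  by (auto simp: sections_def)

text \<open>Smoothness of a section is tested on its coefficients in the local frames. These depend linearly
  on the vector only within the span of the frame, which is the fibre.\<close>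

lemma section_add:
  assumes s: "s \<in> sections M A" and t: "t \<in> sections M A"
  shows "(\<lambda>p. s p + t p) \<in> sections M A"
proof -
  have "smooth_fun_on M W (\<lambda>p. frame_coeff b p (s p + t p) k)" if Wb: "(W, b) \<in> local_frames A" for W b k
  proof (rule smooth_fun_on_cong[OF frame_open[OF Wb]])
    show "smooth_fun_on M W (\<lambda>p. frame_coeff b p (s p) k + frame_coeff b p (t p) k)"
      by (intro smooth_fun_on_add section_smooth_coeff s t Wb frame_open[OF Wb])
  next
    fix p assume p: "p \<in> W"
    show "frame_coeff b p (s p) k + frame_coeff b p (t p) k = frame_coeff b p (s p + t p) k"
      using frame_basis[OF Wb p] section_in_span[OF s Wb p] section_in_span[OF t Wb p]
      by (simp add: frame_coeff_def representation_add)
  qed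
  then show ?thesis
    using s t subspace_add[OF subspace_fibre] by (auto simp: sections_def)
qed

lemma section_scale:
  fixes g :: "'m \<Rightarrow> real"
  assumes s: "s \<in> sections M A" and g: "smooth_fun M g"
  shows "(\<lambda>p. g p *\<^sub>R s p) \<in> sections M A"
proof -
  have "smooth_fun_on M W (\<lambda>p. frame_coeff b p (g p *\<^sub>R s p) k)" if Wb: "(W, b) \<in> local_frames A" for W b k
  proof (rule smooth_fun_on_cong[OF frame_open[OF Wb]])
    show "smooth_fun_on M W (\<lambda>p. g p * frame_coeff b p (s p) k)"
      by (intro smooth_fun_on_mult section_smooth_coeff s Wb frame_open[OF Wb] smooth_fun_on_mono[OF g])
        simp
  next
    fix p assume p: "p \<in> W"
    show "g p * frame_coeff b p (s p) k = frame_coeff b p (g p *\<^sub>R s p) k"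
      using frame_basis[OF Wb p] section_in_span[OF s Wb p]
      by (simp add: frame_coeff_def representation_scale)
  qed
  then show ?thesis
    using s subspace_scale[OF subspace_fibre] by (auto simp: sections_def)
qed

lemma section_zero: "(\<lambda>p. 0) \<in> sections M A"
  using subspace_0[OF subspace_fibre]
  by (auto simp: sections_def frame_coeff_def representation_zero
      intro!: smooth_fun_on_const intro: frame_open)

lemma section_sum:
  "(\<And>i. i \<in> I \<Longrightarrow> s i \<in> sections M A) \<Longrightarrow> (\<lambda>p. \<Sum>i\<in>I. s i p) \<in> sections M A"
  by (induction I rule: infinite_finite_induct) (auto intro: section_zero section_add)

end

context lie_algebroid
begin

lemma bracket_add_right:
  assumes "s \<in> sections M A" "t \<in> sections M A" "t' \<in> sections M A"
  shows "bracket A s (\<lambda>p. t p + t' p) = (\<lambda>p. bracket A s t p + bracket A s t' p)"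
proof -
  have "bracket A s (\<lambda>p. t p + t' p) = (\<lambda>p. - bracket A (\<lambda>p. t p + t' p) s p)"
    using assms by (intro bracket_antisym section_add)
  also have "\<dots> = (\<lambda>p. - bracket A t s p + - bracket A t' s p)"
    using assms by (simp add: bracket_add)
  also have "\<dots> = (\<lambda>p. bracket A s t p + bracket A s t' p)"
    using assms bracket_antisym[of s t] bracket_antisym[of s t'] by simp
  finally show ?thesis .
qed

lemma bracket_zero_right: "s \<in> sections M A \<Longrightarrow> bracket A s (\<lambda>p. 0) = (\<lambda>p. 0)"
  using bracket_add_right[of s "\<lambda>p. 0" "\<lambda>p. 0"] by (simp add: section_zero fun_eq_iff)

lemma bracket_sum_right:
  "\<lbrakk>s \<in> sections M A; \<And>i. i \<in> I \<Longrightarrow> t i \<in> sections M A\<rbrakk> \<Longrightarrow>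
    bracket A s (\<lambda>p. \<Sum>i\<in>I. t i p) = (\<lambda>p. \<Sum>i\<in>I. bracket A s (t i) p)"
  by (induction I rule: infinite_finite_induct)
    (auto simp: bracket_zero_right bracket_add_right section_sum)

end

locale framed_lie_algebroid = lie_algebroid M A
  for M :: "('m::{t2_space, second_countable_topology}, 'i, 'n::finite) atlas"
    and A :: "('m, 'i, 'n, 'j::finite, 'v::real_vector) algebroid" +
  fixes e :: "'j \<Rightarrow> 'm \<Rightarrow> 'v"
    and f :: "'j \<Rightarrow> 'j \<Rightarrow> 'j \<Rightarrow> 'm \<Rightarrow> real"
  assumes basis: "section_basis M A e"
    and structure_funs: "structure_functions M A e f"
begin

abbreviation delta :: "'j \<Rightarrow> ('m \<Rightarrow> real) \<Rightarrow> 'm \<Rightarrow> real" where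
  "delta l \<equiv> vf_apply M (anchor_field A (e l))"

lemma basis_section: "e j \<in> sections M A"
  using basis by (simp add: section_basis_def)

lemma structure_smooth: "smooth_fun M (f j k i)"
  using structure_funs by (simp add: structure_functions_def)

lemma bracket_basis: "bracket A (e j) (e k) = (\<lambda>p. \<Sum>i\<in>UNIV. f j k i p *\<^sub>R e i p)"
  using structure_funs by (simp add: structure_functions_def)

lemma smooth_delta: "smooth_fun M g \<Longrightarrow> smooth_fun M (delta l g)"
  by (intro smooth_vf_apply anchor_smooth basis_section)

text \<open>The basis is one of a module over the smooth functions, so coefficients may be compared only when
  they are known to be smooth. For the Jacobi identity below this is where smoothness of the
  functions \<open>\<delta>\<^sub>l f\<close> is needed.\<close>

lemma basis_coefficients_zero:
  assumes g: "\<And>i. smooth_fun M (g i)" and "\<And>p. (\<Sum>i\<in>UNIV. g i p *\<^sub>R e i p) = 0"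
  shows "g i p = 0"
proof -
  define P where "P = (\<lambda>g :: 'j \<Rightarrow> 'm \<Rightarrow> real. (\<forall>j. smooth_fun M (g j)) \<and>
    (\<lambda>p. 0) = (\<lambda>p. \<Sum>j\<in>UNIV. g j p *\<^sub>R e j p))"
  have "\<exists>!g. P g"
    using basis section_zero unfolding section_basis_def P_def by blast
  moreover have "P g"
    using assms by (simp add: P_def)
  moreover have "P (\<lambda>j p. 0)"
    by (simp add: P_def smooth_fun_on_const)
  ultimately have "g = (\<lambda>j p. 0)"
    by blast
  then show ?thesis by simp
qed

lemma structure_antisym: "f j k i p = - f k j i p"
proof -
  have "f j k i p + f k j i p = 0"
  proof (rule basis_coefficients_zero)
    fix p
    have "bracket A (e j) (e k) p = - bracket A (e k) (e j) p"
      using bracket_antisym[OF basis_section basis_section, of j k] by (rule fun_cong)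
    then show "(\<Sum>i\<in>UNIV. (f j k i p + f k j i p) *\<^sub>R e i p) = 0"
      by (simp add: bracket_basis scaleR_left_distrib sum.distrib)
  qed (intro smooth_fun_on_add structure_smooth open_UNIV)
  then show ?thesis by simp
qed

text \<open>The derivative terms come from moving \<open>f\<^sup>j\<^sup>k\<^sub>m\<close> out of the bracket by the Leibniz rule.\<close>

lemma double_bracket_basis:
  "bracket A (e l) (bracket A (e j) (e k)) p =
    (\<Sum>i\<in>UNIV. (delta l (f j k i) p + (\<Sum>m\<in>UNIV. f j k m p * f l m i p)) *\<^sub>R e i p)"
proof -
  have "bracket A (e l) (bracket A (e j) (e k)) p =
      (\<Sum>m\<in>UNIV. f j k m p *\<^sub>R bracket A (e l) (e m) p + delta l (f j k m) p *\<^sub>R e m p)"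
    unfolding bracket_basis[of j k]
    by (simp add: bracket_sum_right section_scale basis_section structure_smooth bracket_leibniz)
  also have "\<dots> = (\<Sum>m\<in>UNIV. \<Sum>i\<in>UNIV. (f j k m p * f l m i p) *\<^sub>R e i p)
      + (\<Sum>i\<in>UNIV. delta l (f j k i) p *\<^sub>R e i p)"
    by (simp add: bracket_basis sum.distrib scaleR_sum_right)
  also have "(\<Sum>m\<in>UNIV. \<Sum>i\<in>UNIV. (f j k m p * f l m i p) *\<^sub>R e i p) =
      (\<Sum>i\<in>UNIV. (\<Sum>m\<in>UNIV. f j k m p * f l m i p) *\<^sub>R e i p)"
    by (subst sum.swap) (simp add: scaleR_sum_left)
  finally show ?thesis
    by (simp add: scaleR_left_distrib sum.distrib)
qed

text \<open>Each component of the Jacobi identity for three basis elements vanishes separately.\<close>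

lemma structure_jacobi:
  defines "J \<equiv> \<lambda>l j k i p. delta l (f j k i) p + (\<Sum>m\<in>UNIV. f j k m p * f l m i p)"
  shows "J l j k i p + J j k l i p + J k l j i p = 0"
proof (rule basis_coefficients_zero)
  fix p
  show "(\<Sum>i\<in>UNIV. (J l j k i p + J j k l i p + J k l j i p) *\<^sub>R e i p) = 0"
    using bracket_jacobi[OF basis_section basis_section basis_section, of l j k p]
    by (simp add: J_def double_bracket_basis scaleR_left_distrib sum.distrib)
next
  fix i
  show "smooth_fun M (\<lambda>p. J l j k i p + J j k l i p + J k l j i p)"
    unfolding J_def
    by (intro smooth_fun_on_add smooth_fun_on_sum smooth_fun_on_mult smooth_delta
        structure_smooth open_UNIV)
qed

end

section \<open>Poisson brackets of the Hamiltonians\<close>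

context affine_cotangent
begin

lemma darboux_inv_darboux: "proj R r \<in> chart_dom M \<alpha> \<Longrightarrow> darboux_inv M R \<alpha> (darboux M R \<alpha> r) = r"
proof -
  assume r: "proj R r \<in> chart_dom M \<alpha>"
  have "inj_on (darboux M R \<alpha>) (proj R -` chart_dom M \<alpha>)"
  proof (rule inj_onI)
    fix r r' assume *: "r \<in> proj R -` chart_dom M \<alpha>" "r' \<in> proj R -` chart_dom M \<alpha>"
      "darboux M R \<alpha> r = darboux M R \<alpha> r'"
    have "chart M \<alpha> (proj R r) = chart M \<alpha> (proj R r')" "momenta R \<alpha> r = momenta R \<alpha> r'"
      using *(3) by (simp_all add: darboux_def)
    moreover from this(1) have "proj R r = proj R r'"
      using *(1,2) by (metis chart_inv_chart vimageE)
    ultimately show "r = r'"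
      using * inj_onD[OF bij_betw_imp_inj_on[OF pieces[of \<alpha>]], of r r'] by simp
  qed
  then show ?thesis
    using r by (simp add: darboux_inv_def)
qed

lemma darboux_surj:
  assumes "z \<in> chart M \<alpha> ` chart_dom M \<alpha> \<times> UNIV"
  obtains r where "proj R r \<in> chart_dom M \<alpha>" "darboux M R \<alpha> r = z"
proof -
  obtain p \<xi> where p: "p \<in> chart_dom M \<alpha>" "z = (chart M \<alpha> p, \<xi>)"
    using assms by auto
  then have "(p, \<xi>) \<in> (\<lambda>r. (proj R r, momenta R \<alpha> r)) ` (proj R -` chart_dom M \<alpha>)"
    using bij_betw_imp_surj_on[OF pieces[of \<alpha>]] by auto
  then show ?thesis
    using p that by (auto simp: darboux_def)
qed

lemma surj_proj: "surj (proj R)"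
  unfolding surj_def
proof
  fix p
  have "(p, 0) \<in> (\<lambda>r. (proj R r, momenta R (chart_at M p) r)) ` (proj R -` chart_dom M (chart_at M p))"
    using bij_betw_imp_surj_on[OF pieces[of "chart_at M p"]] chart_at_in[of p] by auto
  then show "\<exists>r. p = proj R r" by auto
qed

lemma open_darboux_image: "open (chart M \<alpha> ` chart_dom M \<alpha> \<times> (UNIV :: (real ^ 'n) set))"
  by (intro open_Times open_image open_UNIV)

lemma smooth_total_const: "smooth_total M R (\<lambda>r. a)"
  unfolding smooth_total_def comp_def by (simp add: smooth_on_const open_darboux_image)

lemma smooth_total_add:
  "\<lbrakk>smooth_total M R F; smooth_total M R G\<rbrakk> \<Longrightarrow> smooth_total M R (\<lambda>r. F r + G r)"
  unfolding smooth_total_def comp_def by (simp add: smooth_on_add open_darboux_image)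

lemma smooth_total_mult:
  "\<lbrakk>smooth_total M R F; smooth_total M R G\<rbrakk> \<Longrightarrow> smooth_total M R (\<lambda>r. F r * G r)"
  unfolding smooth_total_def comp_def by (simp add: smooth_on_mult open_darboux_image)

lemma smooth_total_sum:
  "(\<And>i. i \<in> I \<Longrightarrow> smooth_total M R (F i)) \<Longrightarrow> smooth_total M R (\<lambda>r. \<Sum>i\<in>I. F i r)"
  by (induction I rule: infinite_finite_induct) (auto intro: smooth_total_const smooth_total_add)

lemma smooth_total_pullback:
  assumes "smooth_fun M g"
  shows "smooth_total M R (g \<circ> proj R)"
  unfolding smooth_total_def
proof
  fix \<alpha>
  let ?U = "chart M \<alpha> ` chart_dom M \<alpha>"
  have "smooth_on (?U \<times> UNIV) (\<lambda>z :: (real ^ 'n) \<times> (real ^ 'n). (g \<circ> chart_inv M \<alpha>) (fst z))"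
    using assms
    by (intro smooth_on_compose_linear[OF open_image open_darboux_image bounded_linear_fst])
      (auto simp: smooth_fun_on_def comp_def)
  then show "smooth_on (?U \<times> UNIV) (g \<circ> proj R \<circ> darboux_inv M R \<alpha>)"
  proof (rule smooth_on_cong[OF open_darboux_image, rotated])
    fix z assume "z \<in> ?U \<times> (UNIV :: (real ^ 'n) set)"
    then obtain r where "proj R r \<in> chart_dom M \<alpha>" "darboux M R \<alpha> r = z"
      by (rule darboux_surj)
    then show "(g \<circ> chart_inv M \<alpha>) (fst z) = (g \<circ> proj R \<circ> darboux_inv M R \<alpha>) z"
      using darboux_inv_darboux[of r \<alpha>] by (auto simp: darboux_def)
  qed
qed

lemma pullback_derivative:
  assumes g: "smooth_fun M g" and r: "proj R r \<in> chart_dom M \<alpha>"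
  shows "frechet_derivative (g \<circ> proj R \<circ> darboux_inv M R \<alpha>) (at (darboux M R \<alpha> r)) =
    (\<lambda>z. frechet_derivative (g \<circ> chart_inv M \<alpha>) (at (chart M \<alpha> (proj R r))) (fst z))"
proof -
  let ?U = "chart M \<alpha> ` chart_dom M \<alpha>" and ?x = "chart M \<alpha> (proj R r)"
  have "(g \<circ> chart_inv M \<alpha> has_derivative frechet_derivative (g \<circ> chart_inv M \<alpha>) (at ?x)) (at (fst (darboux M R \<alpha> r)))"
    using g r smooth_on_has_derivative[OF open_image[of \<alpha>], of "g \<circ> chart_inv M \<alpha>" ?x]
    by (auto simp: smooth_fun_on_def darboux_def)
  then have "((\<lambda>z. (g \<circ> chart_inv M \<alpha>) (fst z)) has_derivative
      (\<lambda>z. frechet_derivative (g \<circ> chart_inv M \<alpha>) (at ?x) (fst z))) (at (darboux M R \<alpha> r))"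
    by (rule has_derivative_compose[OF bounded_linear_imp_has_derivative[OF bounded_linear_fst]])
  then have "(g \<circ> proj R \<circ> darboux_inv M R \<alpha> has_derivative
      (\<lambda>z. frechet_derivative (g \<circ> chart_inv M \<alpha>) (at ?x) (fst z))) (at (darboux M R \<alpha> r))"
  proof (rule has_derivative_transform_within_open[OF _ open_darboux_image[of \<alpha>]])
    show "darboux M R \<alpha> r \<in> ?U \<times> UNIV"
      using r by (simp add: darboux_def)
    fix z assume "z \<in> ?U \<times> (UNIV :: (real ^ 'n) set)"
    then obtain r where "proj R r \<in> chart_dom M \<alpha>" "darboux M R \<alpha> r = z"
      by (rule darboux_surj)
    then show "(g \<circ> chart_inv M \<alpha>) (fst z) = (g \<circ> proj R \<circ> darboux_inv M R \<alpha>) z"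
      using darboux_inv_darboux[of r \<alpha>] by (auto simp: darboux_def)
  qed
  then show ?thesis
    by (rule frechet_derivative_at[symmetric])
qed

lemma linear_chart_derivative:
  assumes "smooth_fun M g" "p \<in> chart_dom M \<alpha>"
  shows "linear (frechet_derivative (g \<circ> chart_inv M \<alpha>) (at (chart M \<alpha> p)))"
proof -
  have "smooth_on (chart M \<alpha> ` chart_dom M \<alpha>) (g \<circ> chart_inv M \<alpha>)"
    using assms(1) by (simp add: smooth_fun_on_def)
  then show ?thesis
    using smooth_on_has_derivative[OF open_image[of \<alpha>]] assms(2) has_derivative_linear by blast
qed

text \<open>Every term of the bracket contains a derivative along the fibres, which kills pullbacks.\<close>

lemma poisson_pullback_pullback:
  assumes "smooth_fun M g" "smooth_fun M g'"
  shows "poisson M R (g \<circ> proj R) (g' \<circ> proj R) = (\<lambda>r. 0)"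
proof
  fix r
  show "poisson M R (g \<circ> proj R) (g' \<circ> proj R) r = 0"
    using linear_0[OF linear_chart_derivative[OF assms(1) chart_at_in]]
      linear_0[OF linear_chart_derivative[OF assms(2) chart_at_in]]
    by (simp add: poisson_def Let_def pullback_derivative[OF assms(1) chart_at_in]
        pullback_derivative[OF assms(2) chart_at_in] chart_at_in)
qed

end

context hamiltonian_algebroid
begin

text \<open>In Darboux coordinates the Hamiltonian of a section is affine in the momenta.\<close>

lemma hamiltonian_local:
  assumes s: "s \<in> sections M A" and z: "z \<in> chart M \<alpha> ` chart_dom M \<alpha> \<times> UNIV"
  shows "(h s \<circ> darboux_inv M R \<alpha>) z =
    ((\<lambda>p. anchor_field A s p \<alpha>) \<circ> chart_inv M \<alpha>) (fst z) \<bullet> snd z + (c \<alpha> s \<circ> chart_inv M \<alpha>) (fst z)"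
proof -
  obtain r where r: "proj R r \<in> chart_dom M \<alpha>" "darboux M R \<alpha> r = z"
    using z by (rule darboux_surj)
  then show ?thesis
    using darboux_inv_darboux[of r \<alpha>] by (auto simp: darboux_def hamiltonian[OF s r(1)])
qed

lemma smooth_anchor_chart:
  "s \<in> sections M A \<Longrightarrow>
    smooth_on (chart M \<alpha> ` chart_dom M \<alpha>) ((\<lambda>p. anchor_field A s p \<alpha>) \<circ> chart_inv M \<alpha>)"
  using anchor_smooth[of s] unfolding vector_field_def smooth_fun_on_def
  by (metis inf.idem)

lemma smooth_cocycle_chart:
  "s \<in> sections M A \<Longrightarrow> smooth_on (chart M \<alpha> ` chart_dom M \<alpha>) (c \<alpha> s \<circ> chart_inv M \<alpha>)"
  using c_smooth[of s \<alpha>] unfolding smooth_fun_on_def by (metis inf.idem)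

lemma smooth_total_hamiltonian:
  assumes s: "s \<in> sections M A"
  shows "smooth_total M R (h s)"
  unfolding smooth_total_def
proof
  fix \<alpha>
  note lin = smooth_on_compose_linear[OF open_image open_darboux_image bounded_linear_fst]
  show "smooth_on (chart M \<alpha> ` chart_dom M \<alpha> \<times> UNIV) (h s \<circ> darboux_inv M R \<alpha>)"
  proof (rule smooth_on_cong[OF open_darboux_image hamiltonian_local[OF s, symmetric]])
    show "smooth_on (chart M \<alpha> ` chart_dom M \<alpha> \<times> UNIV) (\<lambda>z.
        ((\<lambda>p. anchor_field A s p \<alpha>) \<circ> chart_inv M \<alpha>) (fst z) \<bullet> snd z + (c \<alpha> s \<circ> chart_inv M \<alpha>) (fst z))"
      by (intro smooth_on_add smooth_on_inner open_darboux_image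
          smooth_on_linear[OF open_darboux_image bounded_linear_snd]
          lin) (use smooth_anchor_chart[OF s, of \<alpha>] smooth_cocycle_chart[OF s, of \<alpha>] in \<open>auto simp: comp_def\<close>)
  qed
qed

lemma hamiltonian_derivative:
  assumes s: "s \<in> sections M A" and r: "proj R r \<in> chart_dom M \<alpha>"
  shows "frechet_derivative (h s \<circ> darboux_inv M R \<alpha>) (at (darboux M R \<alpha> r)) =
    (\<lambda>z. anchor_field A s (proj R r) \<alpha> \<bullet> snd z
      + frechet_derivative ((\<lambda>p. anchor_field A s p \<alpha>) \<circ> chart_inv M \<alpha>) (at (chart M \<alpha> (proj R r))) (fst z)
          \<bullet> momenta R \<alpha> r
      + frechet_derivative (c \<alpha> s \<circ> chart_inv M \<alpha>) (at (chart M \<alpha> (proj R r))) (fst z))"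
proof -
  let ?U = "chart M \<alpha> ` chart_dom M \<alpha>" and ?x = "chart M \<alpha> (proj R r)"
  let ?V = "(\<lambda>p. anchor_field A s p \<alpha>) \<circ> chart_inv M \<alpha>" and ?C = "c \<alpha> s \<circ> chart_inv M \<alpha>"
  let ?z = "darboux M R \<alpha> r"
  have x: "?x \<in> ?U" "fst ?z = ?x" "snd ?z = momenta R \<alpha> r"
    using r by (auto simp: darboux_def)
  note fst = has_derivative_compose[OF bounded_linear_imp_has_derivative[OF bounded_linear_fst]]
  have "(?V has_derivative frechet_derivative ?V (at ?x)) (at (fst ?z))"
    "(?C has_derivative frechet_derivative ?C (at ?x)) (at (fst ?z))"
    using smooth_on_has_derivative[OF open_image smooth_anchor_chart[OF s] x(1)]
      smooth_on_has_derivative[OF open_image smooth_cocycle_chart[OF s] x(1)] x(2) by auto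
  then have "((\<lambda>z. ?V (fst z) \<bullet> snd z + ?C (fst z)) has_derivative
      (\<lambda>z. (?V (fst ?z) \<bullet> snd z + frechet_derivative ?V (at ?x) (fst z) \<bullet> snd ?z)
        + frechet_derivative ?C (at ?x) (fst z))) (at ?z)"
    by (intro has_derivative_add has_derivative_inner fst
        bounded_linear_imp_has_derivative[OF bounded_linear_snd])
  then have "(h s \<circ> darboux_inv M R \<alpha> has_derivative
      (\<lambda>z. (?V (fst ?z) \<bullet> snd z + frechet_derivative ?V (at ?x) (fst z) \<bullet> snd ?z)
        + frechet_derivative ?C (at ?x) (fst z))) (at ?z)"
    by (rule has_derivative_transform_within_open[OF _ open_darboux_image[of \<alpha>] _
          hamiltonian_local[OF s, symmetric]])
      (use x(1) in \<open>auto simp: darboux_def\<close>)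
  then show ?thesis
    using r x(2,3) by (simp add: frechet_derivative_at[symmetric])
qed

lemma linear_anchor_derivative:
  assumes s: "s \<in> sections M A" and p: "p \<in> chart_dom M \<alpha>"
  shows "linear (frechet_derivative ((\<lambda>p. anchor_field A s p \<alpha>) \<circ> chart_inv M \<alpha>) (at (chart M \<alpha> p)))"
  using smooth_on_has_derivative[OF open_image smooth_anchor_chart[OF s], of "chart M \<alpha> p"] p
    has_derivative_linear by blast

lemma linear_cocycle_derivative:
  assumes s: "s \<in> sections M A" and p: "p \<in> chart_dom M \<alpha>"
  shows "linear (frechet_derivative (c \<alpha> s \<circ> chart_inv M \<alpha>) (at (chart M \<alpha> p)))"
  using smooth_on_has_derivative[OF open_image smooth_cocycle_chart[OF s], of "chart M \<alpha> p"] p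
    has_derivative_linear by blast

text \<open>Only the momentum derivatives of the Hamiltonian contribute, and these are the components of the
  anchor.\<close>

lemma poisson_hamiltonian_pullback:
  assumes s: "s \<in> sections M A" and g: "smooth_fun M g"
  shows "poisson M R (h s) (g \<circ> proj R) = vf_apply M (anchor_field A s) g \<circ> proj R"
proof
  fix r
  define \<alpha> where "\<alpha> = chart_at M (proj R r)"
  define V where "V = anchor_field A s (proj R r) \<alpha>"
  define dg where "dg = frechet_derivative (g \<circ> chart_inv M \<alpha>) (at (chart M \<alpha> (proj R r)))"
  have r: "proj R r \<in> chart_dom M \<alpha>"
    unfolding \<alpha>_def by (rule chart_at_in)
  have lin: "linear dg"
    unfolding dg_def by (rule linear_chart_derivative[OF g r])
  have "poisson M R (h s) (g \<circ> proj R) r = (\<Sum>a\<in>UNIV. V $ a * dg (axis a 1))"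
    using linear_0[OF lin] linear_0[OF linear_anchor_derivative[OF s r]]
      linear_0[OF linear_cocycle_derivative[OF s r]]
    by (simp add: poisson_def Let_def \<alpha>_def[symmetric] pullback_derivative[OF g r]
        hamiltonian_derivative[OF s r] dg_def[symmetric] V_def[symmetric] inner_axis)
  also have "\<dots> = dg V"
    by (rule linear_axis_expansion[OF lin, symmetric])
  finally show "poisson M R (h s) (g \<circ> proj R) r = (vf_apply M (anchor_field A s) g \<circ> proj R) r"
    by (simp add: vf_apply_def \<alpha>_def dg_def V_def Let_def)
qed

lemma poisson_antisym: "poisson M R F G r = - poisson M R G F r"
  by (simp add: poisson_def Let_def sum_negf[symmetric] mult.commute)

text \<open>The part of the bracket linear in the momenta is the pairing with the commutator of the anchors,
  the remaining part is the right hand side of the cocycle condition.\<close>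

lemma poisson_hamiltonians:
  assumes s: "s \<in> sections M A" and t: "t \<in> sections M A"
  shows "poisson M R (h s) (h t) = h (bracket A s t)"
proof
  fix r
  define \<alpha> where "\<alpha> = chart_at M (proj R r)"
  define p \<xi> where "p = proj R r" and "\<xi> = momenta R \<alpha> r"
  define V where "V = (\<lambda>s. anchor_field A s p \<alpha>)"
  define dV where "dV = (\<lambda>s. frechet_derivative ((\<lambda>p. anchor_field A s p \<alpha>) \<circ> chart_inv M \<alpha>) (at (chart M \<alpha> p)))"
  define dC where "dC = (\<lambda>s. frechet_derivative (c \<alpha> s \<circ> chart_inv M \<alpha>) (at (chart M \<alpha> p)))"
  have r: "proj R r \<in> chart_dom M \<alpha>" and p: "p \<in> chart_dom M \<alpha>"
    unfolding \<alpha>_def p_def by (rule chart_at_in)+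
  have st: "bracket A s t \<in> sections M A"
    by (intro bracket_section s t)
  have lin: "linear (\<lambda>u. dV s u \<bullet> \<xi> + dC s u)" if "s \<in> sections M A" for s
    using linear_anchor_derivative[OF that p] linear_cocycle_derivative[OF that p]
    unfolding dV_def dC_def
    by (auto simp: linear_iff inner_add_left algebra_simps)
  have zero: "dV s 0 = 0" "dC s 0 = 0" if "s \<in> sections M A" for s
    using linear_0[OF linear_anchor_derivative[OF that p]]
      linear_0[OF linear_cocycle_derivative[OF that p]]
    unfolding dV_def dC_def by auto
  have deriv: "frechet_derivative (h s \<circ> darboux_inv M R \<alpha>) (at (darboux M R \<alpha> r)) =
      (\<lambda>z. V s \<bullet> snd z + dV s (fst z) \<bullet> \<xi> + dC s (fst z))" if "s \<in> sections M A" for s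
    by (simp add: hamiltonian_derivative[OF that r] V_def dV_def dC_def p_def \<xi>_def)
  have "poisson M R (h s) (h t) r =
      (\<Sum>a\<in>UNIV. V s $ a * (dV t (axis a 1) \<bullet> \<xi> + dC t (axis a 1))
             - (dV s (axis a 1) \<bullet> \<xi> + dC s (axis a 1)) * V t $ a)"
    using zero[OF s] zero[OF t]
    by (simp add: poisson_def Let_def \<alpha>_def[symmetric] deriv[OF s] deriv[OF t] inner_axis)
  also have "\<dots> = (dV t (V s) \<bullet> \<xi> + dC t (V s)) - (dV s (V t) \<bullet> \<xi> + dC s (V t))"
    by (subst (1 2) linear_axis_expansion[OF lin]) (simp_all add: s t sum_subtractf mult.commute)
  also have "\<dots> = vf_bracket M (anchor_field A s) (anchor_field A t) p \<alpha> \<bullet> \<xi> + (dC t (V s) - dC s (V t))"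
    by (simp add: vf_bracket_def dV_def V_def inner_diff_left)
  also have "vf_bracket M (anchor_field A s) (anchor_field A t) p \<alpha> = anchor_field A (bracket A s t) p \<alpha>"
    by (rule anchor_bracket[OF s t p])
  also have "dC t (V s) - dC s (V t) = c \<alpha> (bracket A s t) p"
    using c_cocycle[OF s t p] by (simp add: vf_apply_def Let_def \<alpha>_def p_def dC_def V_def)
  finally show "poisson M R (h s) (h t) r = h (bracket A s t) r"
    using hamiltonian[OF st r] by (simp add: p_def \<xi>_def)
qed

lemma cocycle_linear:
  assumes s: "\<And>i. i \<in> I \<Longrightarrow> s i \<in> sections M A" and g: "\<And>i. i \<in> I \<Longrightarrow> smooth_fun M (g i)"
    and p: "p \<in> chart_dom M \<alpha>"
  shows "c \<alpha> (\<lambda>q. \<Sum>i\<in>I. g i q *\<^sub>R s i q) p = (\<Sum>i\<in>I. g i p * c \<alpha> (s i) p)"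
proof -
  have "c \<alpha> (\<lambda>q. (\<lambda>q. 0 :: real) q *\<^sub>R (\<lambda>q. 0) q) p = 0"
    using p by (subst c_scale) (auto intro: section_zero smooth_fun_on_const)
  then have zero: "c \<alpha> (\<lambda>q. 0) p = 0" by simp
  show ?thesis
    using s g
    by (induction I rule: infinite_finite_induct)
      (auto simp: zero c_add c_scale p section_sum section_scale)
qed

lemma anchor_linear:
  assumes s: "\<And>i. i \<in> I \<Longrightarrow> u i \<in> fibre A p" and p: "p \<in> chart_dom M \<alpha>"
  shows "anchor A p (\<Sum>i\<in>I. a i *\<^sub>R u i) \<alpha> = (\<Sum>i\<in>I. a i *\<^sub>R anchor A p (u i) \<alpha>)"
proof -
  have zero: "anchor A p 0 \<alpha> = 0"
    using anchor_scale[OF subspace_0[OF subspace_fibre] p, of 0] by simp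
  show ?thesis
    using s
    by (induction I rule: infinite_finite_induct)
      (auto simp: zero anchor_add anchor_scale p subspace_sum[OF subspace_fibre]
        subspace_scale[OF subspace_fibre])
qed

lemma hamiltonian_linear:
  assumes s: "\<And>i. i \<in> I \<Longrightarrow> s i \<in> sections M A" and g: "\<And>i. i \<in> I \<Longrightarrow> smooth_fun M (g i)"
  shows "h (\<lambda>q. \<Sum>i\<in>I. g i q *\<^sub>R s i q) r = (\<Sum>i\<in>I. g i (proj R r) * h (s i) r)"
proof -
  define \<alpha> where "\<alpha> = chart_at M (proj R r)"
  have r: "proj R r \<in> chart_dom M \<alpha>"
    unfolding \<alpha>_def by (rule chart_at_in)
  have fib: "s i (proj R r) \<in> fibre A (proj R r)" if "i \<in> I" for i
    using s[OF that] by (simp add: sections_def)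
  have sum: "(\<lambda>q. \<Sum>i\<in>I. g i q *\<^sub>R s i q) \<in> sections M A"
    by (intro section_sum section_scale s g)
  show ?thesis
    by (simp add: hamiltonian[OF sum r] hamiltonian[OF s r] cocycle_linear s g r anchor_field_def
        anchor_linear[OF fib r] inner_sum_left sum.distrib algebra_simps)
qed

end

section \<open>Calculus in the ghost algebra\<close>

lemma ghost_algebra_eqI: "(\<And>S r. coefficient X S r = coefficient Y S r) \<Longrightarrow> X = Y"
  by (metis coefficient_inverse ext)

lemma coefficient_simps [simp]:
  "coefficient 0 S r = 0" "coefficient (X + Y) S r = coefficient X S r + coefficient Y S r"
  "coefficient (x *\<^sub>R X) S r = x * coefficient X S r"
  "coefficient (- X) S r = - coefficient X S r"
  "coefficient (of_fun g) S r = (if S = {} then g r else 0)"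
  "coefficient (generator a) S r = (if S = {a} then 1 else 0)"
  by (simp_all add: zero_ghost_algebra.rep_eq plus_ghost_algebra.rep_eq scaleR_ghost_algebra.rep_eq
      uminus_ghost_algebra.rep_eq of_fun.rep_eq generator.rep_eq)

lemma coefficient_sum [simp]: "coefficient (sum X I) S r = (\<Sum>i\<in>I. coefficient (X i) S r)"
  by (induction I rule: infinite_finite_induct) auto

lemma coefficient_of_fun_mult [simp]: "coefficient (of_fun g * X) S r = g r * coefficient X S r"
proof -
  have "coefficient (of_fun g * X) S r = (\<Sum>T\<in>Pow S. if T = {} then g r * coefficient X S r else 0)"
    unfolding times_ghost_algebra.rep_eq by (rule sum.cong) auto
  then show ?thesis by simp
qed

lemma coefficient_generator_mult:
  "coefficient (generator a * X) S r =
    (if a \<in> S then reorder_sign {a} (S - {a}) * coefficient X (S - {a}) r else 0)"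
proof -
  have "coefficient (generator a * X) S r = (\<Sum>T\<in>Pow S. if T = {a}
      then reorder_sign {a} (S - {a}) * coefficient X (S - {a}) r else 0)"
    unfolding times_ghost_algebra.rep_eq by (rule sum.cong) auto
  then show ?thesis by simp
qed

lemma precedes_antisym: "a \<noteq> b \<Longrightarrow> precedes a b \<longleftrightarrow> \<not> precedes b a"
  by (cases a; cases b) auto

lemma generator_anticommute: "generator a * generator b = - (generator b * generator a)"
proof (rule ghost_algebra_eqI)
  fix S r
  have sign: "reorder_sign {a} {b} = - reorder_sign {b} {a}" if "a \<noteq> b" for a b :: "'a ghost"
  proof -
    have "{(x, y). x \<in> {a} \<and> y \<in> {b} \<and> precedes y x} = (if precedes b a then {(a, b)} else {})"
      "{(x, y). x \<in> {b} \<and> y \<in> {a} \<and> precedes y x} = (if precedes a b then {(b, a)} else {})"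
      by auto
    then show ?thesis
      using precedes_antisym[OF that] by (simp add: reorder_sign_def)
  qed
  show "coefficient (generator a * generator b) S r = coefficient (- (generator b * generator a)) S r"
  proof (cases "a \<noteq> b \<and> S = {a, b}")
    case True
    then have "S - {a} = {b}" "S - {b} = {a}" by auto
    then show ?thesis
      using True sign[of a b] by (simp add: coefficient_generator_mult)
  next
    case False
    then have "\<not> (a \<in> S \<and> S - {a} = {b})" "\<not> (b \<in> S \<and> S - {b} = {a})" by auto
    then show ?thesis
      by (auto simp: coefficient_generator_mult)
  qed
qed

lemma of_fun_1: "of_fun (\<lambda>r. 1) = 1"
  by (rule ghost_algebra_eqI) (simp add: one_ghost_algebra.rep_eq)

subsection \<open>Gradings\<close>

text \<open>Ghost number and order in the ghost momenta are both gradings by a weight on the generators.\<close>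

definition homogeneous :: "('j ghost \<Rightarrow> int) \<Rightarrow> int \<Rightarrow> ('j::{finite, linorder}, 'r) ghost_algebra \<Rightarrow> bool" where
  "homogeneous w n X \<longleftrightarrow> (\<forall>S r. coefficient X S r \<noteq> 0 \<longrightarrow> sum w S = n)"

primrec ghost_weight :: "'j ghost \<Rightarrow> int" where
  "ghost_weight (Eta j) = 1"
| "ghost_weight (Mom j) = - 1"

primrec mom_weight :: "'j ghost \<Rightarrow> int" where
  "mom_weight (Eta j) = 0"
| "mom_weight (Mom j) = 1"

lemma support_iff: "S \<in> support X \<longleftrightarrow> (\<exists>r. coefficient X S r \<noteq> 0)"
  by (auto simp: support_def fun_eq_iff)

lemma sum_ghost_split:
  fixes S :: "'j::finite ghost set"
  shows "sum w S = sum w (S \<inter> range Eta) + sum w (S \<inter> range Mom)"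
proof -
  have "a \<in> range Eta \<union> range Mom" for a :: "'j ghost"
    by (cases a) auto
  then have "S = (S \<inter> range Eta) \<union> (S \<inter> range Mom)"
    by blast
  moreover have "(S \<inter> range Eta) \<inter> (S \<inter> range Mom) = {}" by auto
  ultimately show ?thesis
    by (metis finite sum.union_disjoint)
qed

lemma sum_mom_weight: "sum mom_weight S = int (card (S \<inter> range Mom))"
  for S :: "'j::finite ghost set"
proof -
  have "sum mom_weight (S \<inter> range Eta) = (\<Sum>a\<in>S \<inter> range Eta. 0)"
    "sum mom_weight (S \<inter> range Mom) = (\<Sum>a\<in>S \<inter> range Mom. 1)"
    by (rule sum.cong; auto)+
  then show ?thesis by (simp add: sum_ghost_split[of mom_weight S])
qed

lemma sum_ghost_weight:
  "sum ghost_weight S = int (card (S \<inter> range Eta)) - int (card (S \<inter> range Mom))"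
  for S :: "'j::finite ghost set"
proof -
  have "sum ghost_weight (S \<inter> range Eta) = (\<Sum>a\<in>S \<inter> range Eta. 1)"
    "sum ghost_weight (S \<inter> range Mom) = (\<Sum>a\<in>S \<inter> range Mom. - 1)"
    by (rule sum.cong; auto)+
  then show ?thesis by (simp add: sum_ghost_split[of ghost_weight S])
qed

lemma has_ghost_number_iff: "has_ghost_number n X \<longleftrightarrow> homogeneous ghost_weight n X"
  by (auto simp: has_ghost_number_def homogeneous_def sum_ghost_weight support_iff)

text \<open>All generators have odd ghost number, so parity is the ghost number modulo two.\<close>

lemma even_card_ghost: "even (card S) \<longleftrightarrow> even (sum ghost_weight S)"
  for S :: "'j::finite ghost set"
proof -
  have "int (card S) = (\<Sum>a\<in>S. 1)" by simp
  also have "\<dots> = int (card (S \<inter> range Eta)) + int (card (S \<inter> range Mom))"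
    by (subst sum_ghost_split) simp
  finally have "card S = card (S \<inter> range Eta) + card (S \<inter> range Mom)" by linarith
  then show ?thesis
    by (simp add: sum_ghost_weight)
qed

lemma homogeneous_parity: "\<lbrakk>homogeneous ghost_weight n X; even p \<longleftrightarrow> even n\<rbrakk> \<Longrightarrow> has_parity p X"
  by (auto simp: has_parity_def homogeneous_def support_iff even_card_ghost)

lemma homogeneous_0 [simp]: "homogeneous w n 0"
  by (simp add: homogeneous_def)

lemma homogeneous_add: "\<lbrakk>homogeneous w n X; homogeneous w n Y\<rbrakk> \<Longrightarrow> homogeneous w n (X + Y)"
  unfolding homogeneous_def by (metis add.right_neutral coefficient_simps(2))

lemma homogeneous_scaleR: "homogeneous w n X \<Longrightarrow> homogeneous w n (a *\<^sub>R X)"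
  by (auto simp: homogeneous_def)

lemma homogeneous_uminus: "homogeneous w n X \<Longrightarrow> homogeneous w n (- X)"
  by (auto simp: homogeneous_def)

lemma homogeneous_sign: "homogeneous w n X \<Longrightarrow> homogeneous w n ((- 1) ^ k * X)"
  by (cases "even k") (auto simp: homogeneous_uminus)

lemma homogeneous_sum: "(\<And>i. i \<in> I \<Longrightarrow> homogeneous w n (X i)) \<Longrightarrow> homogeneous w n (sum X I)"
  by (induction I rule: infinite_finite_induct) (auto intro: homogeneous_add)

lemma homogeneous_of_fun: "homogeneous w 0 (of_fun g)"
  by (auto simp: homogeneous_def)

lemma homogeneous_1: "homogeneous w 0 1"
  by (auto simp: homogeneous_def one_ghost_algebra.rep_eq)

lemma homogeneous_generator: "homogeneous w (w a) (generator a)"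
  by (auto simp: homogeneous_def)

lemma homogeneous_mult:
  assumes X: "homogeneous w n X" and Y: "homogeneous w m Y"
  shows "homogeneous w (n + m) (X * Y)"
  unfolding homogeneous_def
proof (intro allI impI)
  fix S r assume "coefficient (X * Y) S r \<noteq> 0"
  then obtain T where T: "T \<subseteq> S" "coefficient X T r \<noteq> 0" "coefficient Y (S - T) r \<noteq> 0"
    unfolding times_ghost_algebra.rep_eq by (metis (no_types, lifting) PowD mult_eq_0_iff sum.not_neutral_contains_not_neutral)
  then have "sum w T = n" "sum w (S - T) = m"
    using X Y by (auto simp: homogeneous_def)
  then show "sum w S = n + m"
    using T(1) sum.subset_diff[of T S w] by simp
qed

lemmas homogeneous_of_fun_mult = homogeneous_mult[OF homogeneous_of_fun, simplified]

subsection \<open>Monomials\<close>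

lift_definition monomial :: "'j ghost set \<Rightarrow> ('j, 'r) ghost_algebra" is
  "\<lambda>S T r. if T = S then 1 else 0" .

definition component :: "('j::{finite, linorder}, 'r) ghost_algebra \<Rightarrow> 'j ghost set \<Rightarrow> ('j, 'r) ghost_algebra" where
  "component X S = of_fun (coefficient X S) * monomial S"

lemma coefficient_component: "coefficient (component X S) T r = (if T = S then coefficient X S r else 0)"
  by (simp add: component_def monomial.rep_eq)

lemma sum_components: "(\<Sum>S\<in>support X. component X S) = X"
  by (rule ghost_algebra_eqI) (auto simp: coefficient_component support_iff)

lemma homogeneous_component: "homogeneous w (sum w S) (component X S)"
  by (auto simp: homogeneous_def coefficient_component split: if_splits)

lemma monomial_empty: "monomial {} = 1"
  by (rule ghost_algebra_eqI) (simp add: monomial.rep_eq one_ghost_algebra.rep_eq)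

lemma reorder_sign_square: "reorder_sign S T * reorder_sign S T = 1"
  by (simp add: reorder_sign_def power_add[symmetric] flip: mult_2)

text \<open>Since reordering costs just a sign, any generator of a monomial may be split off first. This
  makes induction over the set of generators available without reference to their order.\<close>

lemma monomial_insert:
  assumes "a \<notin> S"
  shows "monomial (insert a S) = reorder_sign {a} S *\<^sub>R (generator a * monomial S)"
proof (rule ghost_algebra_eqI)
  fix T r
  have "a \<in> T \<and> T - {a} = S \<longleftrightarrow> T = insert a S"
    using assms by auto
  then show "coefficient (monomial (insert a S)) T r =
      coefficient (reorder_sign {a} S *\<^sub>R (generator a * monomial S)) T r"
    by (auto simp: coefficient_generator_mult monomial.rep_eq reorder_sign_square)
qed

subsection \<open>Evaluation at a point of the phase space\<close>

text \<open>Multiplication is pointwise in the base, so an identity between elements may be checked in the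
  Grassmann algebra over each point, where functions become real scalars.\<close>

definition eval_at :: "'r \<Rightarrow> ('j::{finite, linorder}, 'r) ghost_algebra \<Rightarrow> ('j, unit) ghost_algebra" where
  "eval_at r X = Ghost_algebra (\<lambda>S _. coefficient X S r)"

lemma coefficient_eval_at [simp]: "coefficient (eval_at r X) S t = coefficient X S r"
  by (simp add: eval_at_def Ghost_algebra_inverse)

lemma eval_at_eqI: "(\<And>r. eval_at r X = eval_at r Y) \<Longrightarrow> X = Y"
  by (rule ghost_algebra_eqI) (metis coefficient_eval_at)

lemma eval_at_simps [simp]:
  "eval_at r 0 = 0" "eval_at r (X + Y) = eval_at r X + eval_at r Y"
  "eval_at r (x *\<^sub>R X) = x *\<^sub>R eval_at r X" "eval_at r (- X) = - eval_at r X"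
  "eval_at r (X * Y) = eval_at r X * eval_at r Y"
  "eval_at r (of_fun g) = g r *\<^sub>R 1" "eval_at r (generator a) = generator a"
  by (rule ghost_algebra_eqI; simp add: times_ghost_algebra.rep_eq one_ghost_algebra.rep_eq)+

lemma eval_at_diff [simp]: "eval_at r (X - Y) = eval_at r X - eval_at r Y"
  using eval_at_simps(2)[of r X "- Y"] by simp

lemma eval_at_sum [simp]: "eval_at r (sum X I) = (\<Sum>i\<in>I. eval_at r (X i))"
  by (induction I rule: infinite_finite_induct) auto

section \<open>The algebraic identity behind nilpotency\<close>

lemma sum_rotate: "(\<Sum>l\<in>A. \<Sum>j\<in>B. \<Sum>k\<in>C. g j k l) = (\<Sum>j\<in>B. \<Sum>k\<in>C. \<Sum>l\<in>A. g j k l)"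
  by (subst sum.swap) (rule sum.cong[OF refl], rule sum.swap)

text \<open>Products of three anticommuting elements are invariant under cyclic permutations, so only the
  cyclic sum of the coefficients matters.\<close>

lemma cyclic_sum_zero:
  fixes \<eta> :: "'j::finite \<Rightarrow> 'a::real_algebra_1"
  assumes anti: "\<And>j k. \<eta> j * \<eta> k = - (\<eta> k * \<eta> j)"
    and cyc: "\<And>l j k. c l j k + c j k l + c k l j = 0"
  shows "(\<Sum>l\<in>UNIV. \<Sum>j\<in>UNIV. \<Sum>k\<in>UNIV. c l j k *\<^sub>R (\<eta> l * (\<eta> k * \<eta> j))) = 0" (is "?X = 0")
proof -
  define W where "W = (\<lambda>l j k. \<eta> l * (\<eta> k * \<eta> j))"
  have W: "W j k l = W l j k" for l j k
  proof -
    have "\<eta> j * (\<eta> l * \<eta> k) = - (\<eta> l * \<eta> j) * \<eta> k"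
      by (metis anti mult.assoc)
    also have "\<dots> = \<eta> l * (\<eta> k * \<eta> j)"
      by (metis anti mult.assoc mult_minus_left mult_minus_right)
    finally show ?thesis by (simp add: W_def)
  qed
  have rot: "(\<Sum>l\<in>UNIV. \<Sum>j\<in>UNIV. \<Sum>k\<in>UNIV. c j k l *\<^sub>R W l j k) =
      (\<Sum>l\<in>UNIV. \<Sum>j\<in>UNIV. \<Sum>k\<in>UNIV. c l j k *\<^sub>R W l j k)" for c :: "'j \<Rightarrow> 'j \<Rightarrow> 'j \<Rightarrow> real"
    using sum_rotate[of "\<lambda>j k l. c j k l *\<^sub>R W j k l" UNIV UNIV UNIV] by (simp add: W)
  have "?X + ?X + ?X = (\<Sum>l\<in>UNIV. \<Sum>j\<in>UNIV. \<Sum>k\<in>UNIV. c l j k *\<^sub>R W l j k)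
      + (\<Sum>l\<in>UNIV. \<Sum>j\<in>UNIV. \<Sum>k\<in>UNIV. c j k l *\<^sub>R W l j k)
      + (\<Sum>l\<in>UNIV. \<Sum>j\<in>UNIV. \<Sum>k\<in>UNIV. c k l j *\<^sub>R W l j k)"
    using rot[of c] rot[of "\<lambda>l j k. c j k l"] by (simp add: W_def)
  also have "\<dots> = (\<Sum>l\<in>UNIV. \<Sum>j\<in>UNIV. \<Sum>k\<in>UNIV. (c l j k + c j k l + c k l j) *\<^sub>R W l j k)"
    by (simp add: sum.distrib scaleR_left_distrib)
  also have "\<dots> = 0"
    by (simp add: cyc)
  finally have "(1 + 1 + 1 :: real) *\<^sub>R ?X = 0"
    by (simp only: scaleR_left_distrib scaleR_one)
  then show ?thesis by simp
qed

text \<open>This is \<open>{\<Omega>, \<Omega>} = 0\<close> over a point of the phase space, with \<open>d l j k i\<close> standing for the value of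
  \<open>\<delta>\<^sub>l f\<^sup>j\<^sup>k\<^sub>i\<close>. The first sum is \<open>D (\<Sum> \<eta>\<^sub>l h\<^sup>l)\<close>, the second \<open>D (\<Sum> u\<^sub>i P\<^sup>i)\<close>. The terms with \<open>h\<close> cancel
  by themselves. The coefficient of \<open>P i\<close> is \<open>G i + 2 K i\<close>, where \<open>G\<close> collects the derivatives of the
  structure functions and \<open>K\<close> their products: half of \<open>G\<close> comes from each sum, and \<open>K\<close> once from
  \<open>D u\<^sub>i\<close> and once from \<open>u\<^sub>i D P\<^sup>i\<close>. By the Jacobi identity \<open>G i + 2 K i\<close> is a cubic form with
  vanishing cyclic sums.\<close>

lemma structure_identity:
  fixes \<eta> P :: "'j::finite \<Rightarrow> 'a::real_algebra_1"
    and f :: "'j \<Rightarrow> 'j \<Rightarrow> 'j \<Rightarrow> real" and d :: "'j \<Rightarrow> 'j \<Rightarrow> 'j \<Rightarrow> 'j \<Rightarrow> real"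
  assumes anti: "\<And>j k. \<eta> j * \<eta> k = - (\<eta> k * \<eta> j)"
    and f: "\<And>j k i. f j k i = - f k j i"
    and jacobi: "\<And>l j k i. (d l j k i + (\<Sum>m\<in>UNIV. f j k m * f l m i))
       + (d j k l i + (\<Sum>m\<in>UNIV. f k l m * f j m i))
       + (d k l j i + (\<Sum>m\<in>UNIV. f l j m * f k m i)) = 0"
    and u: "\<And>i. u i = (1 / 2) *\<^sub>R (\<Sum>j\<in>UNIV. \<Sum>k\<in>UNIV. f j k i *\<^sub>R (\<eta> k * \<eta> j))"
  shows "(\<Sum>l\<in>UNIV. h l *\<^sub>R u l - \<eta> l * ((\<Sum>j\<in>UNIV. (\<Sum>i\<in>UNIV. f j l i * h i) *\<^sub>R \<eta> j)
          - (\<Sum>i\<in>UNIV. (1 / 2) *\<^sub>R (\<Sum>j\<in>UNIV. \<Sum>k\<in>UNIV. d l j k i *\<^sub>R (\<eta> k * \<eta> j)) * P i)))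
      + (\<Sum>i\<in>UNIV. (1 / 2) *\<^sub>R (\<Sum>j\<in>UNIV. \<Sum>k\<in>UNIV.
            (\<Sum>l\<in>UNIV. d l j k i *\<^sub>R \<eta> l) * \<eta> k * \<eta> j + f j k i *\<^sub>R (u k * \<eta> j - \<eta> k * u j)) * P i
          + u i * (h i *\<^sub>R 1 - (\<Sum>m\<in>UNIV. (\<Sum>k\<in>UNIV. f i k m *\<^sub>R \<eta> k) * P m))) = 0"
proof -
  define G where "G i = (\<Sum>l\<in>UNIV. \<Sum>j\<in>UNIV. \<Sum>k\<in>UNIV. d l j k i *\<^sub>R (\<eta> l * (\<eta> k * \<eta> j)))" for i
  define K where "K i = (\<Sum>l\<in>UNIV. \<Sum>m\<in>UNIV. f l m i *\<^sub>R (\<eta> l * u m))" for i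
  have u_commute: "u m * \<eta> l = \<eta> l * u m" for m l
  proof -
    have "(\<eta> k * \<eta> j) * \<eta> l = \<eta> l * (\<eta> k * \<eta> j)" for k j
      using arg_cong[OF anti[of j l], of "\<lambda>x. \<eta> k * x"] arg_cong[OF anti[of k l], of "\<lambda>x. x * \<eta> j"]
      by (simp add: mult.assoc)
    then show ?thesis
      by (simp add: u sum_distrib_left sum_distrib_right)
  qed
  have E1: "(\<Sum>l\<in>UNIV. \<eta> l * (\<Sum>j\<in>UNIV. (\<Sum>i\<in>UNIV. f j l i * h i) *\<^sub>R \<eta> j)) = (\<Sum>i\<in>UNIV. (2 * h i) *\<^sub>R u i)"
  proof -
    have "(\<Sum>l\<in>UNIV. \<eta> l * (\<Sum>j\<in>UNIV. (\<Sum>i\<in>UNIV. f j l i * h i) *\<^sub>R \<eta> j)) =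
        (\<Sum>l\<in>UNIV. \<Sum>j\<in>UNIV. \<Sum>i\<in>UNIV. (f j l i * h i) *\<^sub>R (\<eta> l * \<eta> j))"
      by (simp add: sum_distrib_left scaleR_sum_left)
    also have "\<dots> = (\<Sum>j\<in>UNIV. \<Sum>i\<in>UNIV. \<Sum>l\<in>UNIV. (f j l i * h i) *\<^sub>R (\<eta> l * \<eta> j))"
      by (rule sum_rotate)
    also have "\<dots> = (\<Sum>i\<in>UNIV. \<Sum>j\<in>UNIV. \<Sum>l\<in>UNIV. (f j l i * h i) *\<^sub>R (\<eta> l * \<eta> j))"
      by (rule sum.swap)
    also have "\<dots> = (\<Sum>i\<in>UNIV. (2 * h i) *\<^sub>R u i)"
      by (simp add: u scaleR_sum_right mult.commute)
    finally show ?thesis .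
  qed
  have E2: "(\<Sum>l\<in>UNIV. \<eta> l * (\<Sum>i\<in>UNIV. (1 / 2) *\<^sub>R (\<Sum>j\<in>UNIV. \<Sum>k\<in>UNIV. d l j k i *\<^sub>R (\<eta> k * \<eta> j)) * P i))
      = (\<Sum>i\<in>UNIV. (1 / 2) *\<^sub>R G i * P i)"
  proof -
    have "(\<Sum>l\<in>UNIV. \<eta> l * (\<Sum>i\<in>UNIV. (1 / 2) *\<^sub>R (\<Sum>j\<in>UNIV. \<Sum>k\<in>UNIV. d l j k i *\<^sub>R (\<eta> k * \<eta> j)) * P i))
       = (\<Sum>l\<in>UNIV. \<Sum>i\<in>UNIV. (1 / 2) *\<^sub>R (\<Sum>j\<in>UNIV. \<Sum>k\<in>UNIV. d l j k i *\<^sub>R (\<eta> l * (\<eta> k * \<eta> j))) * P i)"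
      by (simp add: sum_distrib_left sum_distrib_right mult.assoc)
    also have "\<dots> = (\<Sum>i\<in>UNIV. \<Sum>l\<in>UNIV. (1 / 2) *\<^sub>R (\<Sum>j\<in>UNIV. \<Sum>k\<in>UNIV. d l j k i *\<^sub>R (\<eta> l * (\<eta> k * \<eta> j))) * P i)"
      by (rule sum.swap)
    also have "\<dots> = (\<Sum>i\<in>UNIV. (1 / 2) *\<^sub>R G i * P i)"
      by (simp add: G_def sum_distrib_right scaleR_sum_right)
    finally show ?thesis .
  qed
  have E3: "(\<Sum>j\<in>UNIV. \<Sum>k\<in>UNIV. (\<Sum>l\<in>UNIV. d l j k i *\<^sub>R \<eta> l) * \<eta> k * \<eta> j) = G i" for i
    unfolding G_def by (simp add: sum_distrib_right mult.assoc) (rule sum_rotate[symmetric])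
  have E4: "(\<Sum>j\<in>UNIV. \<Sum>k\<in>UNIV. f j k i *\<^sub>R (u k * \<eta> j - \<eta> k * u j)) = 2 *\<^sub>R K i" for i
  proof -
    have "(\<Sum>j\<in>UNIV. \<Sum>k\<in>UNIV. f j k i *\<^sub>R (\<eta> k * u j)) = (\<Sum>k\<in>UNIV. \<Sum>j\<in>UNIV. f j k i *\<^sub>R (\<eta> k * u j))"
      by (rule sum.swap)
    also have "\<dots> = - K i"
      unfolding K_def sum_negf[symmetric] scaleR_minus_left[symmetric] f[symmetric] ..
    finally show ?thesis
      by (simp add: scaleR_diff_right sum_subtractf u_commute K_def[symmetric] scaleR_2)
  qed
  have E5: "(\<Sum>i\<in>UNIV. u i * (\<Sum>m\<in>UNIV. (\<Sum>k\<in>UNIV. f i k m *\<^sub>R \<eta> k) * P m)) = - (\<Sum>m\<in>UNIV. K m * P m)"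
  proof -
    have "(\<Sum>i\<in>UNIV. u i * (\<Sum>m\<in>UNIV. (\<Sum>k\<in>UNIV. f i k m *\<^sub>R \<eta> k) * P m)) =
        (\<Sum>i\<in>UNIV. \<Sum>m\<in>UNIV. \<Sum>k\<in>UNIV. f i k m *\<^sub>R (\<eta> k * u i * P m))"
      by (simp add: sum_distrib_left sum_distrib_right mult.assoc[symmetric] u_commute)
    also have "\<dots> = (\<Sum>m\<in>UNIV. \<Sum>k\<in>UNIV. \<Sum>i\<in>UNIV. f i k m *\<^sub>R (\<eta> k * u i * P m))"
      by (rule sum_rotate)
    also have "\<dots> = - (\<Sum>m\<in>UNIV. K m * P m)"
      unfolding K_def sum_negf[symmetric] sum_distrib_right mult_scaleR_left scaleR_minus_left[symmetric]
        f[symmetric] ..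
    finally show ?thesis .
  qed
  have E6: "G i + 2 *\<^sub>R K i = 0" for i
  proof -
    have "2 *\<^sub>R K i = (\<Sum>l\<in>UNIV. \<Sum>m\<in>UNIV. \<Sum>j\<in>UNIV. \<Sum>k\<in>UNIV. (f j k m * f l m i) *\<^sub>R (\<eta> l * (\<eta> k * \<eta> j)))"
      by (simp add: K_def u scaleR_sum_right sum_distrib_left mult.commute)
    also have "\<dots> = (\<Sum>l\<in>UNIV. \<Sum>j\<in>UNIV. \<Sum>k\<in>UNIV. (\<Sum>m\<in>UNIV. f j k m * f l m i) *\<^sub>R (\<eta> l * (\<eta> k * \<eta> j)))"
      unfolding scaleR_sum_left by (rule sum.cong[OF refl], rule sum_rotate)
    finally have "G i + 2 *\<^sub>R K i = (\<Sum>l\<in>UNIV. \<Sum>j\<in>UNIV. \<Sum>k\<in>UNIV.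
        (d l j k i + (\<Sum>m\<in>UNIV. f j k m * f l m i)) *\<^sub>R (\<eta> l * (\<eta> k * \<eta> j)))"
      by (simp add: G_def scaleR_left_distrib sum.distrib)
    also have "\<dots> = 0"
      by (rule cyclic_sum_zero[OF anti]) (rule jacobi)
    finally show ?thesis .
  qed
  have "(\<Sum>i\<in>UNIV. G i * P i) + 2 *\<^sub>R (\<Sum>i\<in>UNIV. K i * P i) = (\<Sum>i\<in>UNIV. (G i + 2 *\<^sub>R K i) * P i)"
    by (simp add: distrib_right sum.distrib scaleR_sum_right)
  then have GK: "(\<Sum>i\<in>UNIV. G i * P i) = - (2 *\<^sub>R (\<Sum>i\<in>UNIV. K i * P i))"
    by (simp add: E6 eq_neg_iff_add_eq_0)
  have u_sum: "(\<Sum>i\<in>UNIV. (2 * h i) *\<^sub>R u i) = 2 *\<^sub>R (\<Sum>i\<in>UNIV. h i *\<^sub>R u i)"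
    by (simp add: scaleR_sum_right)
  have "(\<Sum>i\<in>UNIV. (1 / 2) *\<^sub>R G i * P i) = (1 / 2) *\<^sub>R (\<Sum>i\<in>UNIV. G i * P i)"
    by (simp add: scaleR_sum_right)
  then have half: "(\<Sum>i\<in>UNIV. (1 / 2) *\<^sub>R G i * P i) = - (\<Sum>i\<in>UNIV. K i * P i)"
    "(\<Sum>i\<in>UNIV. (1 / 2) *\<^sub>R (G i + 2 *\<^sub>R K i) * P i) = 0"
    by (simp_all add: GK E6)
  have uh: "(\<Sum>i\<in>UNIV. u i * (h i *\<^sub>R 1)) = (\<Sum>i\<in>UNIV. h i *\<^sub>R u i)"
    by simp
  show ?thesis
    unfolding right_diff_distrib sum_subtractf sum.distrib E1 E2 E3 E4 E5 u_sum uh half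
    by (simp add: scaleR_2)
qed

section \<open>The graded Poisson bracket\<close>

context affine_cotangent
begin

lemma of_fun_BFV:
  assumes "smooth_total M R F"
  shows "of_fun F \<in> BFV M R"
  unfolding BFV_def
proof (intro CollectI allI)
  fix S
  show "smooth_total M R (coefficient (of_fun F) S)"
    using assms by (cases "S = {}") (simp_all add: of_fun.rep_eq smooth_total_const)
qed

lemma generator_BFV: "generator a \<in> BFV M R"
  by (simp add: BFV_def generator.rep_eq smooth_total_const)

lemma monomial_BFV: "monomial S \<in> BFV M R"
  by (simp add: BFV_def monomial.rep_eq smooth_total_const)

lemma zero_BFV: "0 \<in> BFV M R"
  by (simp add: BFV_def zero_ghost_algebra.rep_eq smooth_total_const)

lemma add_BFV: "\<lbrakk>X \<in> BFV M R; Y \<in> BFV M R\<rbrakk> \<Longrightarrow> X + Y \<in> BFV M R"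
  by (simp add: BFV_def plus_ghost_algebra.rep_eq smooth_total_add)

lemma scaleR_BFV: "X \<in> BFV M R \<Longrightarrow> x *\<^sub>R X \<in> BFV M R"
  by (simp add: BFV_def scaleR_ghost_algebra.rep_eq smooth_total_mult smooth_total_const)

lemma mult_BFV: "\<lbrakk>X \<in> BFV M R; Y \<in> BFV M R\<rbrakk> \<Longrightarrow> X * Y \<in> BFV M R"
  by (auto simp: BFV_def times_ghost_algebra.rep_eq
      intro!: smooth_total_sum smooth_total_mult smooth_total_const)

lemma sum_BFV: "(\<And>i. i \<in> I \<Longrightarrow> X i \<in> BFV M R) \<Longrightarrow> sum X I \<in> BFV M R"
  by (induction I rule: infinite_finite_induct) (auto intro: zero_BFV add_BFV)

lemma component_BFV: "X \<in> BFV M R \<Longrightarrow> component X S \<in> BFV M R"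
  unfolding component_def by (intro mult_BFV of_fun_BFV monomial_BFV) (simp add: BFV_def)

lemmas BFV_intros = of_fun_BFV generator_BFV zero_BFV add_BFV scaleR_BFV mult_BFV sum_BFV

end

lemma homogeneous_has_parity: "homogeneous ghost_weight n X \<Longrightarrow> has_parity (nat \<bar>n\<bar>) X"
  by (erule homogeneous_parity) (simp add: even_nat_iff)

lemma of_fun_parity: "has_parity 0 (of_fun g :: ('j::{finite, linorder}, 'r) ghost_algebra)"
  by (rule homogeneous_parity[OF homogeneous_of_fun]) simp

lemma generator_parity: "has_parity 1 (generator a :: ('j::{finite, linorder}, 'r) ghost_algebra)"
  by (rule homogeneous_parity[OF homogeneous_generator]) (cases a; simp)

locale bfv_calculus = affine_cotangent M R + bfv_bracket M R B
  for M :: "('m::{t2_space, second_countable_topology}, 'i, 'n::finite) atlas"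
    and R :: "('m, 'i, 'n, 'r) affine_bundle"
    and B :: "('j::{finite, linorder}, 'r) ghost_algebra \<Rightarrow> ('j, 'r) ghost_algebra
               \<Rightarrow> ('j, 'r) ghost_algebra"
begin

lemma bracket_zero_left: "X \<in> BFV M R \<Longrightarrow> B 0 X = 0"
  using scale_left[of X X 0] by simp

lemma bracket_zero_right: "X \<in> BFV M R \<Longrightarrow> B X 0 = 0"
  using scale_right[of X X 0] by simp

lemma bracket_sum_left:
  "\<lbrakk>\<And>i. i \<in> I \<Longrightarrow> X i \<in> BFV M R; Y \<in> BFV M R\<rbrakk> \<Longrightarrow> B (sum X I) Y = (\<Sum>i\<in>I. B (X i) Y)"
  by (induction I rule: infinite_finite_induct)
    (auto simp: bracket_zero_left add_left sum_BFV)

lemma bracket_sum_right: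
  "\<lbrakk>\<And>i. i \<in> I \<Longrightarrow> Y i \<in> BFV M R; X \<in> BFV M R\<rbrakk> \<Longrightarrow> B X (sum Y I) = (\<Sum>i\<in>I. B X (Y i))"
  by (induction I rule: infinite_finite_induct)
    (auto simp: bracket_zero_right add_right sum_BFV)

lemma fun_generator: "smooth_total M R F \<Longrightarrow> B (of_fun F) (generator a) = 0"
  using antisym[OF of_fun_BFV generator_BFV of_fun_parity generator_parity, of F a]
  by (cases a) (simp_all add: generator_fun)

lemma generator_of_fun: "smooth_total M R F \<Longrightarrow> B (generator a) (of_fun F) = 0"
  by (cases a) (simp_all add: generator_fun)

text \<open>The Leibniz rule carries the statement from functions and generators to the monomials, by
  induction on the set of generators, and additivity carries it to sums of monomials.\<close>

lemma bracket_homogeneous_right: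
  assumes Z: "Z \<in> BFV M R" "homogeneous ghost_weight k Z"
    and funs: "\<And>F. smooth_total M R F \<Longrightarrow> homogeneous ghost_weight k (B Z (of_fun F))"
    and gens: "\<And>a. homogeneous ghost_weight (k + ghost_weight a) (B Z (generator a))"
    and Y: "Y \<in> BFV M R" "homogeneous ghost_weight m Y"
  shows "homogeneous ghost_weight (k + m) (B Z Y)"
proof -
  note pZ = homogeneous_has_parity[OF Z(2)]
  have mono: "homogeneous ghost_weight (sum ghost_weight S) (monomial S)" for S
    by (auto simp: homogeneous_def monomial.rep_eq)
  have mon: "homogeneous ghost_weight (k + sum ghost_weight S) (B Z (monomial S))" for S
  proof (induction S rule: finite_induct[OF finite])
    case 1
    show ?case
      using funs[OF smooth_total_const, of 1] by (simp add: monomial_empty of_fun_1)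
  next
    case (2 a S)
    have "B Z (generator a * monomial S) = B Z (generator a) * monomial S
        + (- 1) ^ (nat \<bar>k\<bar> * 1) * generator a * B Z (monomial S)"
      by (rule leibniz_right[OF Z(1) generator_BFV monomial_BFV pZ generator_parity])
    moreover have "homogeneous ghost_weight (k + ghost_weight a + sum ghost_weight S)
        (B Z (generator a) * monomial S)"
      by (intro homogeneous_mult gens mono)
    moreover have "homogeneous ghost_weight (ghost_weight a + (k + sum ghost_weight S))
        ((- 1) ^ (nat \<bar>k\<bar> * 1) * generator a * B Z (monomial S))"
      unfolding mult.assoc by (intro homogeneous_sign homogeneous_mult homogeneous_generator 2)
    ultimately have "homogeneous ghost_weight (k + (ghost_weight a + sum ghost_weight S))
        (B Z (generator a * monomial S))"
      by (simp add: homogeneous_add algebra_simps)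
    then show ?case
      using 2 by (simp add: monomial_insert scale_right Z mult_BFV generator_BFV monomial_BFV
          homogeneous_scaleR)
  qed
  have comp: "homogeneous ghost_weight (k + sum ghost_weight S) (B Z (component Y S))" for S
  proof -
    let ?F = "coefficient Y S"
    have F: "smooth_total M R ?F"
      using Y(1) by (simp add: BFV_def)
    have "B Z (component Y S) = B Z (of_fun ?F) * monomial S
        + (- 1) ^ (nat \<bar>k\<bar> * 0) * of_fun ?F * B Z (monomial S)"
      unfolding component_def
      by (rule leibniz_right[OF Z(1) of_fun_BFV[OF F] monomial_BFV pZ of_fun_parity])
    moreover have "homogeneous ghost_weight (k + sum ghost_weight S) (B Z (of_fun ?F) * monomial S)"
      by (intro homogeneous_mult funs F mono)
    ultimately show ?thesis
      using homogeneous_of_fun_mult[OF mon] by (simp add: homogeneous_add)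
  qed
  have "B Z Y = (\<Sum>S\<in>support Y. B Z (component Y S))"
    by (subst sum_components[symmetric]) (intro bracket_sum_right component_BFV Y Z)
  moreover have "homogeneous ghost_weight (k + m) (B Z (component Y S))" if "S \<in> support Y" for S
    using comp[of S] that Y(2) by (auto simp: support_iff homogeneous_def)
  ultimately show ?thesis
    by (simp add: homogeneous_sum)
qed

text \<open>In the first argument the conclusion is kept for a single monomial term: its ghost number is
  defined even if that of \<open>X\<close> is not.\<close>

lemma bracket_homogeneous_left:
  assumes Z: "Z \<in> BFV M R" "homogeneous ghost_weight k Z"
    and funs: "\<And>F. smooth_total M R F \<Longrightarrow> homogeneous ghost_weight k (B (of_fun F) Z)"
    and gens: "\<And>a. homogeneous ghost_weight (k + ghost_weight a) (B (generator a) Z)"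
    and X: "X \<in> BFV M R"
  shows "homogeneous ghost_weight (sum ghost_weight S + k) (B (component X S) Z)"
proof -
  note pZ = homogeneous_has_parity[OF Z(2)]
  have mono: "homogeneous ghost_weight (sum ghost_weight S) (monomial S)" for S
    by (auto simp: homogeneous_def monomial.rep_eq)
  have mon: "homogeneous ghost_weight (k + sum ghost_weight S) (B (monomial S) Z)" for S
  proof (induction S rule: finite_induct[OF finite])
    case 1
    show ?case
      using funs[OF smooth_total_const, of 1] by (simp add: monomial_empty of_fun_1)
  next
    case (2 a S)
    let ?q = "nat \<bar>sum ghost_weight S\<bar>"
    have "B (generator a * monomial S) Z = generator a * B (monomial S) Z
        + (- 1) ^ (?q * nat \<bar>k\<bar>) * B (generator a) Z * monomial S"
      by (rule leibniz_left[OF generator_BFV monomial_BFV Z(1) homogeneous_has_parity[OF mono] pZ])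
    moreover have "homogeneous ghost_weight (ghost_weight a + (k + sum ghost_weight S))
        (generator a * B (monomial S) Z)"
      by (intro homogeneous_mult homogeneous_generator 2)
    moreover have "homogeneous ghost_weight (k + ghost_weight a + sum ghost_weight S)
        ((- 1) ^ (?q * nat \<bar>k\<bar>) * B (generator a) Z * monomial S)"
      by (intro homogeneous_sign homogeneous_mult gens mono)
    ultimately have "homogeneous ghost_weight (k + (ghost_weight a + sum ghost_weight S))
        (B (generator a * monomial S) Z)"
      by (simp add: homogeneous_add algebra_simps)
    then show ?case
      using 2 by (simp add: monomial_insert scale_left Z mult_BFV generator_BFV monomial_BFV
          homogeneous_scaleR)
  qed
  let ?F = "coefficient X S" and ?q = "nat \<bar>sum ghost_weight S\<bar>"
  have F: "smooth_total M R ?F"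
    using X by (simp add: BFV_def)
  have "B (component X S) Z = of_fun ?F * B (monomial S) Z
      + (- 1) ^ (?q * nat \<bar>k\<bar>) * B (of_fun ?F) Z * monomial S"
    unfolding component_def
    by (rule leibniz_left[OF of_fun_BFV[OF F] monomial_BFV Z(1) homogeneous_has_parity[OF mono] pZ])
  moreover have "homogeneous ghost_weight (k + sum ghost_weight S)
      ((- 1) ^ (?q * nat \<bar>k\<bar>) * B (of_fun ?F) Z * monomial S)"
    by (intro homogeneous_sign homogeneous_mult funs F mono)
  ultimately show ?thesis
    using homogeneous_of_fun_mult[OF mon] by (simp add: homogeneous_add add.commute)
qed

lemma bracket_component_homogeneous:
  assumes X: "X \<in> BFV M R" and Y: "Y \<in> BFV M R" "homogeneous ghost_weight m Y"
  shows "homogeneous ghost_weight (sum ghost_weight S + m) (B (component X S) Y)"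
proof (rule bracket_homogeneous_left[OF Y _ _ X])
  fix F assume F: "smooth_total M R F"
  have "homogeneous ghost_weight (0 + m) (B (of_fun F) Y)"
    by (rule bracket_homogeneous_right[OF of_fun_BFV[OF F] homogeneous_of_fun _ _ Y])
      (simp_all add: fun_fun fun_generator F homogeneous_of_fun)
  then show "homogeneous ghost_weight m (B (of_fun F) Y)" by simp
next
  fix a
  have gen_gen: "homogeneous ghost_weight (ghost_weight a + ghost_weight b) (B (generator a) (generator b))" for b
    by (cases a; cases b) (simp_all add: eta_eta mom_mom eta_mom homogeneous_1)
  have "homogeneous ghost_weight (ghost_weight a + m) (B (generator a) Y)"
    by (rule bracket_homogeneous_right[OF generator_BFV homogeneous_generator _ gen_gen Y])
      (simp add: generator_of_fun)
  then show "homogeneous ghost_weight (m + ghost_weight a) (B (generator a) Y)"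
    by (simp add: add.commute)
qed

lemma bracket_components:
  "\<lbrakk>X \<in> BFV M R; Y \<in> BFV M R\<rbrakk> \<Longrightarrow> B X Y = (\<Sum>S\<in>support X. B (component X S) Y)"
  by (subst sum_components[of X, symmetric]) (intro bracket_sum_left component_BFV; simp)

lemma bracket_ghost_number:
  assumes X: "X \<in> BFV M R" "has_ghost_number n X" and Y: "Y \<in> BFV M R" "has_ghost_number m Y"
  shows "has_ghost_number (n + m) (B X Y)"
proof -
  have "homogeneous ghost_weight (n + m) (B (component X S) Y)" if "S \<in> support X" for S
    using bracket_component_homogeneous[OF X(1) Y(1), of m S] that X(2) Y(2)
    by (auto simp: has_ghost_number_iff support_iff homogeneous_def)
  then show ?thesis
    unfolding has_ghost_number_iff bracket_components[OF X(1) Y(1)] by (rule homogeneous_sum)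
qed

text \<open>The graded Jacobi identity and antisymmetry give \<open>2 {{\<psi>, \<Omega>}, \<Omega>} = {\<psi>, {\<Omega>, \<Omega>}}\<close>; the parity of \<open>{\<psi>, \<Omega>}\<close>
  that antisymmetry asks for comes from its ghost number.\<close>

lemma nilpotent_homogeneous:
  assumes Om: "\<Omega> \<in> BFV M R" "has_ghost_number 1 \<Omega>" "B \<Omega> \<Omega> = 0"
    and psi: "\<psi> \<in> BFV M R" "has_ghost_number n \<psi>"
  shows "B (B \<psi> \<Omega>) \<Omega> = 0"
proof -
  define p where "p = nat \<bar>n\<bar>"
  have odd: "has_parity 1 \<Omega>" and par: "has_parity p \<psi>"
    using Om(2) psi(2) by (auto simp: has_ghost_number_iff p_def even_nat_iff intro: homogeneous_parity)
  have "homogeneous ghost_weight (n + 1) (B \<psi> \<Omega>)"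
    using bracket_ghost_number[OF psi Om(1,2)] by (simp add: has_ghost_number_iff)
  then have par': "has_parity (p + 1) (B \<psi> \<Omega>)"
    by (rule homogeneous_parity) (simp add: p_def even_nat_iff)
  have "B \<psi> (B \<Omega> \<Omega>) = B (B \<psi> \<Omega>) \<Omega> + (- 1) ^ (p * 1) * B \<Omega> (B \<psi> \<Omega>)"
    by (rule jacobi[OF psi(1) Om(1) Om(1) par odd])
  moreover have "B \<Omega> (B \<psi> \<Omega>) = - ((- 1) ^ (1 * (p + 1)) * B (B \<psi> \<Omega>) \<Omega>)"
    by (rule antisym[OF Om(1) closed[OF psi(1) Om(1)] odd par'])
  ultimately have "B (B \<psi> \<Omega>) \<Omega> + B (B \<psi> \<Omega>) \<Omega> = 0"
    using Om(3) bracket_zero_right[OF psi(1)] by (cases "even p") simp_all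
  then have "2 *\<^sub>R B (B \<psi> \<Omega>) \<Omega> = 0"
    by (simp only: scaleR_2)
  then show ?thesis by simp
qed

text \<open>An arbitrary \<open>\<psi>\<close> is a sum of monomial terms, each of which has a ghost number.\<close>

lemma nilpotent:
  assumes Om: "\<Omega> \<in> BFV M R" "has_ghost_number 1 \<Omega>" "B \<Omega> \<Omega> = 0" and psi: "\<psi> \<in> BFV M R"
  shows "B (B \<psi> \<Omega>) \<Omega> = 0"
proof -
  have "has_ghost_number (sum ghost_weight S) (component \<psi> S)" for S
    unfolding has_ghost_number_iff by (rule homogeneous_component)
  then have "B (B (component \<psi> S) \<Omega>) \<Omega> = 0" for S
    by (intro nilpotent_homogeneous[OF Om component_BFV[OF psi]])
  moreover have "B (B \<psi> \<Omega>) \<Omega> = (\<Sum>S\<in>support \<psi>. B (B (component \<psi> S) \<Omega>) \<Omega>)"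
    unfolding bracket_components[OF psi Om(1)]
    by (intro bracket_sum_left closed component_BFV psi Om(1))
  ultimately show ?thesis by simp
qed

end

section \<open>The BRST charge of a Hamiltonian algebroid\<close>

locale brst_setting = hamiltonian_algebroid M A R c h + framed_lie_algebroid M A e f
    + bfv_calculus M R B
  for M :: "('m::{t2_space, second_countable_topology}, 'i, 'n::finite) atlas"
    and A :: "('m, 'i, 'n, 'j::{finite, linorder}, 'v::real_vector) algebroid"
    and R :: "('m, 'i, 'n, 'r) affine_bundle"
    and c :: "'i \<Rightarrow> ('m \<Rightarrow> 'v) \<Rightarrow> 'm \<Rightarrow> real"
    and h :: "('m \<Rightarrow> 'v) \<Rightarrow> 'r \<Rightarrow> real"
    and e :: "'j \<Rightarrow> 'm \<Rightarrow> 'v"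
    and f :: "'j \<Rightarrow> 'j \<Rightarrow> 'j \<Rightarrow> 'm \<Rightarrow> real"
    and B :: "('j, 'r) ghost_algebra \<Rightarrow> ('j, 'r) ghost_algebra \<Rightarrow> ('j, 'r) ghost_algebra"
begin

abbreviation phi :: "'j \<Rightarrow> 'j \<Rightarrow> 'j \<Rightarrow> 'r \<Rightarrow> real" where
  "phi j k i \<equiv> f j k i \<circ> proj R"

abbreviation ham :: "'j \<Rightarrow> 'r \<Rightarrow> real" where
  "ham j \<equiv> h (e j)"

text \<open>The component of \<open>\<onehalf> \<lfloor>\<eta>, \<eta>'\<rfloor>\<close> along the basis element \<open>e\<^sup>i\<close>.\<close>

definition ghost_bracket :: "'j \<Rightarrow> ('j, 'r) ghost_algebra" where
  "ghost_bracket i = (1 / 2) *\<^sub>R (\<Sum>j\<in>UNIV. \<Sum>k\<in>UNIV. of_fun (phi j k i) * eta k * eta j)"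

definition linear_charge :: "('j, 'r) ghost_algebra" where
  "linear_charge = (\<Sum>j\<in>UNIV. eta j * of_fun (ham j))"

definition cubic_charge :: "('j, 'r) ghost_algebra" where
  "cubic_charge = (\<Sum>i\<in>UNIV. ghost_bracket i * mom i)"

definition charge :: "('j, 'r) ghost_algebra" where
  "charge = linear_charge + cubic_charge"

lemma brst_charge_eq: "brst_charge R ham f = charge"
  unfolding charge_def brst_charge_def linear_charge_def cubic_charge_def ghost_bracket_def
  by (simp add: scaleR_sum_right sum_distrib_right)

lemma phi_smooth: "smooth_total M R (phi j k i)"
  by (intro smooth_total_pullback structure_smooth)

lemma ham_smooth: "smooth_total M R (ham j)"
  by (intro smooth_total_hamiltonian basis_section)

lemma ghost_bracket_BFV: "ghost_bracket i \<in> BFV M R"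
  unfolding ghost_bracket_def by (intro BFV_intros phi_smooth)

lemma linear_charge_BFV: "linear_charge \<in> BFV M R"
  unfolding linear_charge_def by (intro BFV_intros ham_smooth)

lemma cubic_charge_BFV: "cubic_charge \<in> BFV M R"
  unfolding cubic_charge_def by (intro BFV_intros ghost_bracket_BFV)

lemma charge_BFV: "charge \<in> BFV M R"
  unfolding charge_def by (intro BFV_intros linear_charge_BFV cubic_charge_BFV)

lemma ghost_bracket_homogeneous:
  assumes "\<And>j. w (Eta j) = x"
  shows "homogeneous w (x + x) (ghost_bracket i)"
proof -
  have "homogeneous w (0 + w (Eta k) + w (Eta j)) (of_fun (phi j k i) * eta k * eta j)" for j k
    by (intro homogeneous_mult homogeneous_of_fun homogeneous_generator)
  then have "homogeneous w (x + x) (of_fun (phi j k i) * eta k * eta j)" for j k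
    by (simp only: assms add_0)
  then show ?thesis
    unfolding ghost_bracket_def by (intro homogeneous_scaleR homogeneous_sum)
qed

lemma ghost_bracket_weights:
  "homogeneous ghost_weight 2 (ghost_bracket i)" "homogeneous mom_weight 0 (ghost_bracket i)"
  using ghost_bracket_homogeneous[of ghost_weight 1] ghost_bracket_homogeneous[of mom_weight 0] by simp_all

lemma ghost_bracket_parity: "has_parity 0 (ghost_bracket i)"
  by (rule homogeneous_parity[OF ghost_bracket_weights(1)]) simp

lemma linear_charge_homogeneous:
  "homogeneous ghost_weight 1 linear_charge" "homogeneous mom_weight 0 linear_charge"
proof -
  have "homogeneous w (w (Eta j) + 0) (eta j * of_fun (ham j))" for j w
    by (intro homogeneous_mult homogeneous_of_fun homogeneous_generator)
  from this[where w = ghost_weight] this[where w = mom_weight] show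
    "homogeneous ghost_weight 1 linear_charge" "homogeneous mom_weight 0 linear_charge"
    unfolding linear_charge_def by (auto intro: homogeneous_sum)
qed

lemma cubic_charge_homogeneous:
  "homogeneous ghost_weight 1 cubic_charge" "homogeneous mom_weight 1 cubic_charge"
proof -
  have "homogeneous ghost_weight (2 + ghost_weight (Mom i)) (ghost_bracket i * mom i)" for i
    by (intro homogeneous_mult ghost_bracket_weights homogeneous_generator)
  moreover have "homogeneous mom_weight (0 + mom_weight (Mom i)) (ghost_bracket i * mom i)" for i
    by (intro homogeneous_mult ghost_bracket_weights homogeneous_generator)
  ultimately show "homogeneous ghost_weight 1 cubic_charge" "homogeneous mom_weight 1 cubic_charge"
    unfolding cubic_charge_def by (auto intro: homogeneous_sum)
qed

lemma charge_ghost_number: "has_ghost_number 1 charge"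
  unfolding charge_def has_ghost_number_iff
  by (intro homogeneous_add linear_charge_homogeneous cubic_charge_homogeneous)

lemma charge_parity: "has_parity 1 charge"
  using charge_ghost_number by (auto simp: has_ghost_number_iff intro: homogeneous_parity)

subsection \<open>Brackets with the two parts of the charge\<close>

lemmas mem = BFV_intros phi_smooth ham_smooth ghost_bracket_BFV linear_charge_BFV cubic_charge_BFV charge_BFV

lemma of_fun_eta_parity: "has_parity 1 (of_fun g * eta k :: ('j, 'r) ghost_algebra)"
proof (rule homogeneous_parity)
  show "homogeneous ghost_weight (0 + ghost_weight (Eta k)) (of_fun g * eta k :: ('j, 'r) ghost_algebra)"
    by (intro homogeneous_mult homogeneous_of_fun homogeneous_generator)
qed simp

lemma ghost_bracket_fun:
  assumes F: "smooth_total M R F"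
  shows "B (ghost_bracket i) (of_fun F) =
    (1 / 2) *\<^sub>R (\<Sum>j\<in>UNIV. \<Sum>k\<in>UNIV. of_fun (poisson M R (phi j k i) F) * eta k * eta j)"
proof -
  have "B (of_fun (phi j k i) * eta k * eta j) (of_fun F) =
      of_fun (poisson M R (phi j k i) F) * eta k * eta j" for j k
  proof -
    have "B (of_fun (phi j k i) * eta k) (of_fun F) =
        of_fun (phi j k i) * B (eta k) (of_fun F) + (- 1) ^ (1 * 0) * B (of_fun (phi j k i)) (of_fun F) * eta k"
      by (rule leibniz_left) (intro mem F of_fun_parity generator_parity)+
    moreover have "B (of_fun (phi j k i) * eta k * eta j) (of_fun F) =
        of_fun (phi j k i) * eta k * B (eta j) (of_fun F)
        + (- 1) ^ (1 * 0) * B (of_fun (phi j k i) * eta k) (of_fun F) * eta j"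
      by (rule leibniz_left) (intro mem F of_fun_parity generator_parity)+
    ultimately show ?thesis
      by (simp add: generator_of_fun F fun_fun phi_smooth)
  qed
  then show ?thesis
    unfolding ghost_bracket_def by (simp add: scale_left bracket_sum_left mem F)
qed

lemma ghost_bracket_eta: "B (ghost_bracket i) (eta l) = 0"
proof -
  have "B (of_fun (phi j k i) * eta k * eta j) (eta l) = 0" for j k
  proof -
    have "B (of_fun (phi j k i) * eta k) (eta l) =
        of_fun (phi j k i) * B (eta k) (eta l) + (- 1) ^ (1 * 1) * B (of_fun (phi j k i)) (eta l) * eta k"
      by (rule leibniz_left) (intro mem generator_parity)+
    moreover have "B (of_fun (phi j k i) * eta k * eta j) (eta l) =
        of_fun (phi j k i) * eta k * B (eta j) (eta l)
        + (- 1) ^ (1 * 1) * B (of_fun (phi j k i) * eta k) (eta l) * eta j"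
      by (rule leibniz_left) (intro mem generator_parity)+
    ultimately show ?thesis
      by (simp add: fun_generator eta_eta phi_smooth)
  qed
  then show ?thesis
    unfolding ghost_bracket_def by (simp add: scale_left bracket_sum_left mem)
qed

text \<open>Contracting either ghost with the momentum gives the same contribution, by antisymmetry of the
  structure functions; this absorbs the factor one half.\<close>

lemma ghost_bracket_mom:
  "B (ghost_bracket i) (mom l) = (\<Sum>k\<in>UNIV. of_fun (phi l k i) * eta k)" (is "_ = ?X")
proof -
  have "B (of_fun (phi j k i) * eta k * eta j) (mom l) =
      (if j = l then of_fun (phi j k i) * eta k else 0) - (if k = l then of_fun (phi j k i) * eta j else 0)" for j k
  proof -
    have "B (of_fun (phi j k i) * eta k) (mom l) =
        of_fun (phi j k i) * B (eta k) (mom l) + (- 1) ^ (1 * 1) * B (of_fun (phi j k i)) (mom l) * eta k"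
      by (rule leibniz_left) (intro mem generator_parity)+
    moreover have "B (of_fun (phi j k i) * eta k * eta j) (mom l) =
        of_fun (phi j k i) * eta k * B (eta j) (mom l)
        + (- 1) ^ (1 * 1) * B (of_fun (phi j k i) * eta k) (mom l) * eta j"
      by (rule leibniz_left) (intro mem generator_parity)+
    ultimately show ?thesis
      by (simp add: fun_generator eta_mom phi_smooth)
  qed
  then have "B (ghost_bracket i) (mom l) = (1 / 2) *\<^sub>R
      ((\<Sum>j\<in>UNIV. \<Sum>k\<in>UNIV. if j = l then of_fun (phi j k i) * eta k else 0)
       - (\<Sum>j\<in>UNIV. \<Sum>k\<in>UNIV. if k = l then of_fun (phi j k i) * eta j else 0))"
    unfolding ghost_bracket_def by (simp add: scale_left bracket_sum_left mem sum_subtractf)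
  also have "(\<Sum>j\<in>UNIV. \<Sum>k\<in>UNIV. if j = l then of_fun (phi j k i) * eta k else 0) = ?X"
    by (subst sum.swap) simp
  also have "(\<Sum>j\<in>UNIV. \<Sum>k\<in>UNIV. if k = l then of_fun (phi j k i) * eta j else 0) = - ?X"
  proof -
    have "(of_fun (phi j l i) :: ('j, 'r) ghost_algebra) = - of_fun (phi l j i)" for j
      by (rule ghost_algebra_eqI) (simp add: structure_antisym[of j l])
    then have "(\<Sum>j\<in>UNIV. of_fun (phi j l i) * eta j) = (\<Sum>j\<in>UNIV. - of_fun (phi l j i) * eta j)"
      by (intro sum.cong) auto
    then show ?thesis
      by (simp add: sum_negf)
  qed
  also have "(1 / 2) *\<^sub>R (?X - - ?X) = ?X"
    by (simp only: diff_minus_eq_add scaleR_2[symmetric] scaleR_scaleR) simp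
  finally show ?thesis .
qed

lemma linear_charge_fun:
  assumes F: "smooth_total M R F"
  shows "B linear_charge (of_fun F) = (\<Sum>j\<in>UNIV. eta j * of_fun (poisson M R (ham j) F))"
proof -
  have "B (eta j * of_fun (ham j)) (of_fun F) =
      eta j * B (of_fun (ham j)) (of_fun F) + (- 1) ^ (0 * 0) * B (eta j) (of_fun F) * of_fun (ham j)" for j
    by (rule leibniz_left) (intro mem F of_fun_parity)+
  then show ?thesis
    unfolding linear_charge_def
    by (simp add: bracket_sum_left mem F generator_of_fun fun_fun ham_smooth)
qed

lemma linear_charge_generator:
  "B linear_charge (eta l) = 0" "B linear_charge (mom l) = of_fun (ham l)"
proof -
  have "B (eta j * of_fun (ham j)) (generator a) =
      eta j * B (of_fun (ham j)) (generator a) + (- 1) ^ (0 * 1) * B (eta j) (generator a) * of_fun (ham j)" for j a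
    by (rule leibniz_left) (intro mem of_fun_parity generator_parity)+
  then have *: "B linear_charge (generator a) = (\<Sum>j\<in>UNIV. B (eta j) (generator a) * of_fun (ham j))" for a
    unfolding linear_charge_def by (simp add: bracket_sum_left mem fun_generator ham_smooth)
  show "B linear_charge (eta l) = 0"
    by (simp add: * eta_eta)
  have "B linear_charge (mom l) = (\<Sum>j\<in>UNIV. if j = l then of_fun (ham l) else 0)"
    unfolding * by (rule sum.cong) (auto simp: eta_mom)
  then show "B linear_charge (mom l) = of_fun (ham l)" by simp
qed

lemma cubic_charge_fun:
  assumes F: "smooth_total M R F"
  shows "B cubic_charge (of_fun F) = (\<Sum>i\<in>UNIV. B (ghost_bracket i) (of_fun F) * mom i)"
proof -
  have "B (ghost_bracket i * mom i) (of_fun F) =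
      ghost_bracket i * B (mom i) (of_fun F) + (- 1) ^ (1 * 0) * B (ghost_bracket i) (of_fun F) * mom i" for i
    by (rule leibniz_left) (intro mem F of_fun_parity generator_parity)+
  then show ?thesis
    unfolding cubic_charge_def by (simp add: bracket_sum_left mem F generator_of_fun)
qed

lemma cubic_charge_generator:
  "B cubic_charge (eta l) = ghost_bracket l"
  "B cubic_charge (mom l) = - (\<Sum>i\<in>UNIV. (\<Sum>k\<in>UNIV. of_fun (phi l k i) * eta k) * mom i)"
proof -
  have "B (ghost_bracket i * mom i) (generator a) =
      ghost_bracket i * B (mom i) (generator a) + (- 1) ^ (1 * 1) * B (ghost_bracket i) (generator a) * mom i" for i a
    by (rule leibniz_left) (intro mem generator_parity)+
  then have *: "B cubic_charge (generator a) = (\<Sum>i\<in>UNIV.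
      ghost_bracket i * B (mom i) (generator a) - B (ghost_bracket i) (generator a) * mom i)" for a
    unfolding cubic_charge_def by (simp add: bracket_sum_left mem)
  have "B cubic_charge (eta l) = (\<Sum>i\<in>UNIV. if i = l then ghost_bracket l else 0)"
    unfolding * by (rule sum.cong) (auto simp: eta_mom ghost_bracket_eta)
  then show "B cubic_charge (eta l) = ghost_bracket l" by simp
  show "B cubic_charge (mom l) = - (\<Sum>i\<in>UNIV. (\<Sum>k\<in>UNIV. of_fun (phi l k i) * eta k) * mom i)"
    unfolding * by (simp add: mom_mom ghost_bracket_mom sum_negf)
qed

subsection \<open>The charge as a derivation\<close>

lemma charge_add: "X \<in> BFV M R \<Longrightarrow> B charge X = B linear_charge X + B cubic_charge X"
  by (simp add: charge_def add_left linear_charge_BFV cubic_charge_BFV)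

text \<open>The values of \<open>{\<Omega>, \<cdot>}\<close> on the generators, the structure functions and the Hamiltonians. Those on
  \<open>u\<^sub>i\<close> and on \<open>\<Omega>\<close> itself follow by the Leibniz rule.\<close>

lemma charge_eta: "B charge (eta l) = ghost_bracket l"
  by (simp add: charge_add generator_BFV linear_charge_generator cubic_charge_generator)

lemma charge_mom: "B charge (mom l) =
    of_fun (ham l) - (\<Sum>i\<in>UNIV. (\<Sum>k\<in>UNIV. of_fun (phi l k i) * eta k) * mom i)"
  by (simp add: charge_add generator_BFV linear_charge_generator cubic_charge_generator)

lemma charge_phi: "B charge (of_fun (phi j k i)) = (\<Sum>l\<in>UNIV. eta l * of_fun (delta l (f j k i) \<circ> proj R))"
proof -
  have zero: "of_fun (\<lambda>r. 0) = 0"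
    by (rule ghost_algebra_eqI) simp
  show ?thesis
    by (simp add: charge_add of_fun_BFV phi_smooth linear_charge_fun cubic_charge_fun ghost_bracket_fun
        poisson_hamiltonian_pullback basis_section structure_smooth poisson_pullback_pullback zero)
qed

lemma poisson_ham_ham: "poisson M R (ham j) (ham l) = (\<lambda>r. \<Sum>i\<in>UNIV. phi j l i r * ham i r)"
proof
  fix r
  show "poisson M R (ham j) (ham l) r = (\<Sum>i\<in>UNIV. phi j l i r * ham i r)"
    using hamiltonian_linear[of UNIV e "f j l" r]
    by (simp add: poisson_hamiltonians basis_section structure_smooth bracket_basis)
qed

lemma poisson_phi_ham: "poisson M R (phi j k i) (ham l) = (\<lambda>r. - delta l (f j k i) (proj R r))"
proof
  fix r
  show "poisson M R (phi j k i) (ham l) r = - delta l (f j k i) (proj R r)"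
    using poisson_antisym[of "phi j k i" "ham l" r]
    by (simp add: poisson_hamiltonian_pullback basis_section structure_smooth)
qed

lemma charge_ham: "B charge (of_fun (ham l)) =
    (\<Sum>j\<in>UNIV. eta j * of_fun (\<lambda>r. \<Sum>i\<in>UNIV. phi j l i r * ham i r))
    + (\<Sum>i\<in>UNIV. (1 / 2) *\<^sub>R (\<Sum>j\<in>UNIV. \<Sum>k\<in>UNIV.
          of_fun (\<lambda>r. - delta l (f j k i) (proj R r)) * eta k * eta j) * mom i)"
  by (simp add: charge_add of_fun_BFV ham_smooth linear_charge_fun cubic_charge_fun ghost_bracket_fun
      poisson_ham_ham poisson_phi_ham)

lemma charge_ghost_bracket: "B charge (ghost_bracket i) = (1 / 2) *\<^sub>R (\<Sum>j\<in>UNIV. \<Sum>k\<in>UNIV.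
    (\<Sum>l\<in>UNIV. eta l * of_fun (delta l (f j k i) \<circ> proj R)) * eta k * eta j
    + of_fun (phi j k i) * (ghost_bracket k * eta j - eta k * ghost_bracket j))"
proof -
  have "B charge (of_fun (phi j k i) * eta k * eta j) =
      B charge (of_fun (phi j k i)) * eta k * eta j
      + of_fun (phi j k i) * (ghost_bracket k * eta j - eta k * ghost_bracket j)" for j k
  proof -
    have "B charge (of_fun (phi j k i) * eta k) = B charge (of_fun (phi j k i)) * eta k
        + (- 1) ^ (1 * 0) * of_fun (phi j k i) * B charge (eta k)"
      by (rule leibniz_right) (intro mem charge_parity of_fun_parity)+
    moreover have "B charge (of_fun (phi j k i) * eta k * eta j) =
        B charge (of_fun (phi j k i) * eta k) * eta j
        + (- 1) ^ (1 * 1) * (of_fun (phi j k i) * eta k) * B charge (eta j)"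
      by (rule leibniz_right) (intro mem charge_parity of_fun_eta_parity)+
    ultimately show ?thesis
      by (simp add: charge_eta right_diff_distrib distrib_right mult.assoc)
  qed
  then show ?thesis
    unfolding ghost_bracket_def[of i]
    by (simp add: scale_right bracket_sum_right mem charge_phi)
qed

lemma charge_charge: "B charge charge = 0"
proof -
  have lin: "B charge linear_charge =
      (\<Sum>l\<in>UNIV. ghost_bracket l * of_fun (ham l) - eta l * B charge (of_fun (ham l)))"
  proof -
    have "B charge (eta l * of_fun (ham l)) = B charge (eta l) * of_fun (ham l)
        + (- 1) ^ (1 * 1) * eta l * B charge (of_fun (ham l))" for l
      by (rule leibniz_right) (intro mem charge_parity generator_parity)+
    then show ?thesis
      unfolding linear_charge_def[THEN arg_cong[of _ _ "B charge"]]
      by (simp add: bracket_sum_right mem charge_eta)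
  qed
  have cub: "B charge cubic_charge =
      (\<Sum>i\<in>UNIV. B charge (ghost_bracket i) * mom i + ghost_bracket i * B charge (mom i))"
  proof -
    have "B charge (ghost_bracket i * mom i) = B charge (ghost_bracket i) * mom i
        + (- 1) ^ (1 * 0) * ghost_bracket i * B charge (mom i)" for i
      by (rule leibniz_right) (intro mem charge_parity ghost_bracket_parity)+
    then show ?thesis
      unfolding cubic_charge_def[THEN arg_cong[of _ _ "B charge"]]
      by (simp add: bracket_sum_right mem)
  qed
  (* Over a point all coefficients become real scalars, and the sums take the form treated in
     structure_identity. *)
  have "eval_at r (B charge linear_charge + B charge cubic_charge) = eval_at r 0" for r
  proof -
    let ?p = "proj R r"
    have u: "eval_at r (ghost_bracket i) =
        (1 / 2) *\<^sub>R (\<Sum>j\<in>UNIV. \<Sum>k\<in>UNIV. f j k i ?p *\<^sub>R (eta k * eta j))" for i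
      by (simp add: ghost_bracket_def)
    show ?thesis
      unfolding lin cub charge_ham charge_ghost_bracket charge_mom
      using structure_identity[of eta "\<lambda>j k i. f j k i ?p" "\<lambda>l j k i. delta l (f j k i) ?p"
          "\<lambda>i. eval_at r (ghost_bracket i)" "\<lambda>l. ham l r" mom, OF generator_anticommute
          structure_antisym structure_jacobi u]
      by (simp add: sum_negf)
  qed
  then have "B charge linear_charge + B charge cubic_charge = 0"
    by (rule eval_at_eqI)
  then show ?thesis
    by (simp add: charge_def[THEN arg_cong[of _ _ "B charge"]] add_right mem)
qed

subsection \<open>The rank of the charge\<close>

lemma order_support:
  assumes "homogeneous mom_weight n X" "S \<in> support X"
  shows "int (card (S \<inter> range Mom)) = n"
  using assms by (auto simp: homogeneous_def support_iff sum_mom_weight)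

lemma charge_order: "S \<in> support charge \<Longrightarrow> card (S \<inter> range Mom) \<le> 1"
proof -
  assume "S \<in> support charge"
  then have "S \<in> support linear_charge \<or> S \<in> support cubic_charge"
    by (auto simp: support_iff charge_def)
  then show ?thesis
    using order_support[OF linear_charge_homogeneous(2)] order_support[OF cubic_charge_homogeneous(2)]
    by fastforce
qed

lemma bfv_rank_le: "bfv_rank charge \<le> 1"
  unfolding bfv_rank_def using charge_order by (subst Max_le_iff) auto

text \<open>The structure functions can be read off from the cubic term by bracketing it with \<open>\<eta>\<^sub>i\<close> and
  then with \<open>P\<^sup>j\<close>.\<close>

lemma cubic_charge_nonzero:
  assumes "f j k i p \<noteq> 0"
  shows "cubic_charge \<noteq> 0"
proof
  assume "cubic_charge = 0"
  then have "ghost_bracket i = 0"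
    using cubic_charge_generator(1)[of i] bracket_zero_left[OF generator_BFV] by simp
  then have "(\<Sum>k\<in>UNIV. of_fun (phi j k i) * eta k) = 0"
    using ghost_bracket_mom[of i j] bracket_zero_left[OF generator_BFV] by simp
  moreover obtain r where "proj R r = p"
    using surj_proj by (metis surjD)
  moreover have "coefficient (\<Sum>k\<in>UNIV. of_fun (phi j k i) * eta k) {Eta k} r = phi j k i r"
  proof -
    have "coefficient (\<Sum>k\<in>UNIV. of_fun (phi j k i) * eta k) {Eta k} r =
        (\<Sum>k'\<in>UNIV. if k' = k then phi j k i r else 0)"
      unfolding coefficient_sum by (rule sum.cong) auto
    then show ?thesis by simp
  qed
  ultimately show False
    using assms by simp
qed

text \<open>The two parts of the charge have different orders in the momenta, so the linear part cannot
  cancel a term of the cubic part.\<close>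

lemma bfv_rank_eq:
  assumes "f j k i p \<noteq> 0"
  shows "bfv_rank charge = 1"
proof -
  obtain S r where S: "coefficient cubic_charge S r \<noteq> 0"
    using cubic_charge_nonzero[OF assms] ghost_algebra_eqI[of cubic_charge 0] by auto
  then have order: "card (S \<inter> range Mom) = 1"
    using order_support[OF cubic_charge_homogeneous(2), of S] by (auto simp: support_iff)
  then have "coefficient linear_charge S r = 0"
    using order_support[OF linear_charge_homogeneous(2), of S] by (auto simp: support_iff)
  then have "S \<in> support charge"
    using S by (auto simp: support_iff charge_def intro!: exI[of _ r])
  then have "1 \<le> bfv_rank charge"
    unfolding bfv_rank_def order[symmetric] by (intro Max_ge) auto
  then show ?thesis
    using bfv_rank_le by simp
qed

lemma charge_generates_brst: "generates_brst M R B ham f charge"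
  unfolding generates_brst_def brst_op_def brst_charge_eq
proof (intro conjI allI ballI impI)
  show "\<exists>Z\<in>BFV M R. (\<forall>S\<in>support Z. 2 \<le> card (S \<inter> range Mom)) \<and> charge = charge + Z"
    by (rule bexI[OF _ zero_BFV]) (simp add: support_iff)
qed (use nilpotent[OF charge_BFV charge_ghost_number charge_charge] charge_BFV charge_parity
      bracket_ghost_number[OF _ _ charge_BFV charge_ghost_number] in auto)

end

theorem theorem2p1:
  fixes M :: "('m::{t2_space, second_countable_topology}, 'i, 'n::finite) atlas"
    and A :: "('m, 'i, 'n, 'j::{finite, linorder}, 'v::real_vector) algebroid"
    and R :: "('m, 'i, 'n, 'r) affine_bundle"
    and c :: "'i \<Rightarrow> ('m \<Rightarrow> 'v) \<Rightarrow> 'm \<Rightarrow> real"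
    and h :: "('m \<Rightarrow> 'v) \<Rightarrow> 'r \<Rightarrow> real"
    and e :: "'j \<Rightarrow> 'm \<Rightarrow> 'v"
    and f :: "'j \<Rightarrow> 'j \<Rightarrow> 'j \<Rightarrow> 'm \<Rightarrow> real"
    and B :: "('j, 'r) ghost_algebra \<Rightarrow> ('j, 'r) ghost_algebra \<Rightarrow> ('j, 'r) ghost_algebra"
    and \<Omega> :: "('j, 'r) ghost_algebra"
  assumes "hamiltonian_algebroid M A R c h"
    and "section_basis M A e"
    and "structure_functions M A e f"
    and "bfv_bracket M R B"
    and "\<Omega> = brst_charge R (\<lambda>j. h (e j)) f"
  shows "B \<Omega> \<Omega> = 0 \<and>
    generates_brst M R B (\<lambda>j. h (e j)) f \<Omega> \<and>
    bfv_rank \<Omega> \<le> 1 \<and>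
    ((\<exists>i j k p. f j k i p \<noteq> 0) \<longrightarrow> bfv_rank \<Omega> = 1)"
proof -
  interpret hamiltonian_algebroid M A R c h
    by (rule assms(1))
  interpret bfv_bracket M R B
    by (rule assms(4))
  interpret brst_setting M A R c h e f B
    by unfold_locales (rule assms(2,3))+
  show ?thesis
    unfolding assms(5) brst_charge_eq
    using charge_charge charge_generates_brst bfv_rank_le bfv_rank_eq by blast
qed

end
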